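(* Let $\mathcal L=\{R_1,R_2,\dots\}$, where each $R_k$ is a relation symbol of arity $k$. Then the relation of bi-Lipschitz isomorphism between compact metric $\mathcal L$-structures is Borel bireducible with the complete $K_\sigma$ equivalence relation.
   Context: A compact metric $\mathcal L$-structure is a tuple $(M,d,(R_k^{\mathcal M})_k)$ with $(M,d)$ a compact metric space and each $R_k^{\mathcal M}\subseteq M^k$ closed. A bi-Lipschitz isomorphism between two such structures $\mathcal M,\mathcal N$ is a bijection $\phi\colon M\to N$ such that $\phi$ and $\phi^{-1}$ are Lipschitz and for all $k$ and $x_1,\dots,x_k\in M$, $(x_1,\dots,x_k)\in R_k^{\mathcal M}\iff(\phi(x_1),\dots,\phi(x_k))\in R_k^{\mathcal N}$. Compact metric structures are parametrized as compact subsets of the Urysohn metric space equipped with closed relations, giving a standard Borel space. A $K_\sigma$ equivalence relation on a Polish space $X$ is one that is a countable union of compact subsets of $X^2$; the complete $K_\sigma$ equivalence relation is a $K_\sigma$ equivalence relation to which every $K_\sigma$ equivalence relation is Borel reducible. Borel bireducible means each relation is Borel reducible to the other. *)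

theory Defs
  imports "HOL-Analysis.Analysis"
begin

section \<open>Compact metric structures\<close>

text \<open>
  The language has one relation symbol of arity \<open>k\<close> for each \<open>k \<ge> 1\<close>. The power \<open>M\<^sup>k\<close> is the set
  \<open>{..<k} \<rightarrow>\<^sub>E M\<close> of extensional functions, that is, the carrier of the library's product topology.
  A family of relations is a function on \<open>nat\<close> of which only the values at \<open>k \<ge> 1\<close> matter.
\<close>

abbreviation power_topology :: "'a topology \<Rightarrow> nat \<Rightarrow> (nat \<Rightarrow> 'a) topology" where
  "power_topology X k \<equiv> product_topology (\<lambda>_. X) {..<k}"

definition compact_metric_structure :: "'a metric \<Rightarrow> (nat \<Rightarrow> (nat \<Rightarrow> 'a) set) \<Rightarrow> bool" where
  "compact_metric_structure m R \<longleftrightarrow>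
     compact_space (mtopology_of m) \<and>
     (\<forall>k\<ge>1. closedin (power_topology (mtopology_of m) k) (R k))"

definition bi_Lipschitz_isomorphism ::
    "'a metric \<Rightarrow> (nat \<Rightarrow> (nat \<Rightarrow> 'a) set) \<Rightarrow> 'b metric \<Rightarrow> (nat \<Rightarrow> (nat \<Rightarrow> 'b) set)
      \<Rightarrow> ('a \<Rightarrow> 'b) \<Rightarrow> bool" where
  "bi_Lipschitz_isomorphism m R n S \<phi> \<longleftrightarrow>
     bij_betw \<phi> (mspace m) (mspace n) \<and>
     Lipschitz_continuous_map m n \<phi> \<and>
     Lipschitz_continuous_map n m (inv_into (mspace m) \<phi>) \<and>
     (\<forall>k\<ge>1. \<forall>x \<in> {..<k} \<rightarrow>\<^sub>E mspace m. x \<in> R k \<longleftrightarrow> restrict (\<phi> \<circ> x) {..<k} \<in> S k)"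


section \<open>The Urysohn space\<close>

definition isometry_on :: "'a set \<Rightarrow> 'a metric \<Rightarrow> 'b metric \<Rightarrow> ('a \<Rightarrow> 'b) \<Rightarrow> bool" where
  "isometry_on A m n f \<longleftrightarrow>
     f \<in> A \<rightarrow> mspace n \<and> (\<forall>x\<in>A. \<forall>y\<in>A. mdist n (f x) (f y) = mdist m x y)"

text \<open>
  The Urysohn space is, up to isometry, the unique complete separable metric space that is
  universal for separable metric spaces and ultrahomogeneous. The test spaces for universality
  must live on a fixed type. All separable metric spaces have isometric copies carried by sets
  of real sequences, so nothing is lost; see \<open>Urysohn_universal\<close>.
\<close>

definition Urysohn_space :: "'a metric \<Rightarrow> bool" where
  "Urysohn_space U \<longleftrightarrow>
     mcomplete_of U \<and> separable_space (mtopology_of U) \<and>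
     (\<forall>m :: (nat \<Rightarrow> real) metric. separable_space (mtopology_of m) \<longrightarrow>
        (\<exists>f. isometry_on (mspace m) m U f)) \<and>
     (\<forall>F f. finite F \<and> F \<subseteq> mspace U \<and> isometry_on F U U f \<longrightarrow>
        (\<exists>g. isometry_on (mspace U) U U g \<and> g ` mspace U = mspace U \<and> (\<forall>x\<in>F. g x = f x)))"


section \<open>The space of compact metric structures\<close>

text \<open>The Vietoris topology on the set of compact subsets of \<open>X\<close>, the empty set included.\<close>

definition Vietoris_topology :: "'a topology \<Rightarrow> 'a set topology" where
  "Vietoris_topology X = topology_generated_by
     ({{K. compactin X K \<and> K \<subseteq> V} | V. openin X V} \<union>
      {{K. compactin X K \<and> K \<inter> V \<noteq> {}} | V. openin X V})"

definition structure_codes :: "'a metric \<Rightarrow> ('a set \<times> (nat \<Rightarrow> (nat \<Rightarrow> 'a) set)) set" where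
  "structure_codes U =
     {(M, R). M \<subseteq> mspace U \<and> R \<in> extensional {1..} \<and>
              compact_metric_structure (submetric U M) R}"

text \<open>
  A closed relation on a compact \<open>M \<subseteq> U\<close> of arity \<open>k\<close> is a compact subset of \<open>U\<^sup>k\<close>, so the codes form
  a subset of \<open>K(U) \<times> (\<Prod>k\<ge>1. K(U\<^sup>k))\<close>, and carry its topology.
\<close>

definition structure_topology :: "'a metric \<Rightarrow> ('a set \<times> (nat \<Rightarrow> (nat \<Rightarrow> 'a) set)) topology" where
  "structure_topology U = subtopology
     (prod_topology (Vietoris_topology (mtopology_of U))
        (product_topology (\<lambda>k. Vietoris_topology (power_topology (mtopology_of U) k)) {1..}))
     (structure_codes U)"

definition bi_Lipschitz_isomorphic ::
    "'a metric \<Rightarrow> (('a set \<times> (nat \<Rightarrow> (nat \<Rightarrow> 'a) set)) \<times> ('a set \<times> (nat \<Rightarrow> (nat \<Rightarrow> 'a) set))) set" where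
  "bi_Lipschitz_isomorphic U =
     {((M, R), (N, S)). (M, R) \<in> structure_codes U \<and> (N, S) \<in> structure_codes U \<and>
        (\<exists>\<phi>. bi_Lipschitz_isomorphism (submetric U M) R (submetric U N) S \<phi>)}"


section \<open>Borel reducibility and \<open>K\<^sub>\<sigma>\<close> equivalence relations\<close>

definition borel_of :: "'a topology \<Rightarrow> 'a measure" where
  "borel_of X = sigma (topspace X) {V. openin X V}"

definition Borel_reducible ::
    "'a measure \<Rightarrow> ('a \<times> 'a) set \<Rightarrow> 'b measure \<Rightarrow> ('b \<times> 'b) set \<Rightarrow> bool" where
  "Borel_reducible A E B F \<longleftrightarrow>
     (\<exists>f \<in> measurable A B. \<forall>x \<in> space A. \<forall>y \<in> space A. (x, y) \<in> E \<longleftrightarrow> (f x, f y) \<in> F)"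

definition Borel_bireducible ::
    "'a measure \<Rightarrow> ('a \<times> 'a) set \<Rightarrow> 'b measure \<Rightarrow> ('b \<times> 'b) set \<Rightarrow> bool" where
  "Borel_bireducible A E B F \<longleftrightarrow> Borel_reducible A E B F \<and> Borel_reducible B F A E"

definition Polish_topology :: "'a topology \<Rightarrow> bool" where
  "Polish_topology X \<longleftrightarrow> completely_metrizable_space X \<and> separable_space X"

definition K_sigma_equivalence :: "'a topology \<Rightarrow> ('a \<times> 'a) set \<Rightarrow> bool" where
  "K_sigma_equivalence X E \<longleftrightarrow>
     Polish_topology X \<and> equiv (topspace X) E \<and>
     (countable union_of compactin (prod_topology X X)) E"

text \<open>
  Again the spaces quantified over must live on a fixed type, and every Polish space has a
  homeomorphic copy on a set of real sequences; see \<open>complete_K_sigma_reducible\<close>.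
\<close>

definition complete_K_sigma_equivalence :: "'a topology \<Rightarrow> ('a \<times> 'a) set \<Rightarrow> bool" where
  "complete_K_sigma_equivalence X E \<longleftrightarrow>
     K_sigma_equivalence X E \<and>
     (\<forall>(Y :: (nat \<Rightarrow> real) topology) F. K_sigma_equivalence Y F \<longrightarrow>
        Borel_reducible (borel_of Y) F (borel_of X) E)"


section \<open>Adequacy of the definitions\<close>

lemma topspace_Vietoris: "topspace (Vietoris_topology X) = {K. compactin X K}"
proof -
  have "\<Union>({{K. compactin X K \<and> K \<subseteq> V} | V. openin X V} \<union>
           {{K. compactin X K \<and> K \<inter> V \<noteq> {}} | V. openin X V}) = {K. compactin X K}"
    (is "\<Union>?B = _")
  proof
    show "\<Union>?B \<subseteq> {K. compactin X K}" by auto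
    have "{K. compactin X K} = {K. compactin X K \<and> K \<subseteq> topspace X}"
      using compactin_subset_topspace by blast
    then have "{K. compactin X K} \<in> ?B"
      using openin_topspace[of X] by (intro UnI1 CollectI exI[of _ "topspace X"] conjI)
    then show "{K. compactin X K} \<subseteq> \<Union>?B" by (rule Union_upper)
  qed
  then show ?thesis
    unfolding Vietoris_topology_def topology_generated_by_topspace .
qed

lemma space_borel_of [simp]: "space (borel_of X) = topspace X"
  unfolding borel_of_def by (rule space_measure_of) (auto dest: openin_subset)

lemma sets_borel_of: "sets (borel_of X) = sigma_sets (topspace X) {V. openin X V}"
  unfolding borel_of_def by (rule sets_measure_of) (auto dest: openin_subset)

lemma continuous_map_borel_of:
  assumes "continuous_map X Y f"
  shows "f \<in> measurable (borel_of X) (borel_of Y)"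
proof (rule measurable_sigma_sets[OF sets_borel_of])
  show "{V. openin Y V} \<subseteq> Pow (topspace Y)" by (auto dest: openin_subset)
  show "f \<in> space (borel_of X) \<rightarrow> topspace Y"
    using assms by (auto simp: continuous_map_def)
  fix V assume "V \<in> {V. openin Y V}"
  then have "openin X (f -` V \<inter> topspace X)"
    using assms by (simp add: continuous_map_def vimage_def Int_def conj_commute)
  then show "f -` V \<inter> space (borel_of X) \<in> sets (borel_of X)"
    by (simp add: sets_borel_of)
qed

lemma topspace_structure_topology: "topspace (structure_topology U) = structure_codes U"
proof -
  have "compactin (mtopology_of U) M \<and>
        (\<forall>k\<in>{1..}. compactin (power_topology (mtopology_of U) k) (R k)) \<and> R \<in> extensional {1..}"
    if "(M, R) \<in> structure_codes U" for M R
  proof -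
    have M: "M \<subseteq> mspace U" and R: "R \<in> extensional {1..}"
      and c: "compact_space (subtopology (mtopology_of U) M)"
      and cl: "\<And>k. k \<ge> 1 \<Longrightarrow> closedin (power_topology (subtopology (mtopology_of U) M) k) (R k)"
      using that by (auto simp: structure_codes_def compact_metric_structure_def mtopology_of_submetric)
    have *: "compactin (power_topology (mtopology_of U) k) (R k)" if "k \<ge> 1" for k
    proof -
      have "compact_space (power_topology (subtopology (mtopology_of U) M) k)"
        using c by (simp add: compact_space_product_topology)
      then have "compactin (power_topology (subtopology (mtopology_of U) M) k) (R k)"
        using cl[OF that] closedin_compact_space by blast
      then show ?thesis
        by (simp add: subtopology_product_topology[symmetric] compactin_subtopology)
    qed
    show ?thesis using M R c * by (auto simp: compactin_subspace)
  qed
  then show ?thesis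
    by (auto simp: structure_topology_def topspace_Vietoris PiE_def)
qed

lemma separable_metric_inj:
  fixes m :: "'a metric"
  assumes "separable_space (mtopology_of m)"
  shows "\<exists>g :: 'a \<Rightarrow> nat \<Rightarrow> real. inj_on g (mspace m)"
proof (cases "mspace m = {}")
  case False
  obtain C where C: "countable C" "C \<subseteq> mspace m" "mtopology_of m closure_of C = mspace m"
    using assms by (auto simp: separable_space_def)
  have ne: "C \<noteq> {}" using C(3) False by auto
  define q where "q = from_nat_into C"
  have q: "range q = C" unfolding q_def using C(1) ne by simp
  have "x = y" if x: "x \<in> mspace m" and y: "y \<in> mspace m"
    and eq: "(\<lambda>n. mdist m x (q n)) = (\<lambda>n. mdist m y (q n))" for x y
  proof (rule ccontr)
    assume "x \<noteq> y"
    then have "mdist m x y \<noteq> 0" using x y by simp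
    then have pos: "mdist m x y / 2 > 0" using mdist_nonneg[of m x y] by linarith
    interpret Metric_space "mspace m" "mdist m" by simp
    have "x \<in> mtopology closure_of C" using C(3) x by (simp add: mtopology_of_def)
    then obtain c where c: "c \<in> C" "c \<in> mball x (mdist m x y / 2)"
      using pos unfolding metric_closure_of by blast
    obtain n where n: "c = q n" using c q by auto
    have "c \<in> mspace m" and less: "mdist m x c < mdist m x y / 2" using c(2) by simp_all
    then have "mdist m x y \<le> mdist m x c + mdist m y c"
      using x y by (intro triangle')
    moreover have "mdist m y c = mdist m x c" using fun_cong[OF eq, of n] n by simp
    ultimately show False using less by linarith
  qed
  then show ?thesis by (intro exI[of _ "\<lambda>x n. mdist m x (q n)"]) (auto simp: inj_on_def)
qed auto

lemma Polish_inj: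
  fixes Y :: "'a topology"
  assumes "Polish_topology Y"
  shows "\<exists>g :: 'a \<Rightarrow> nat \<Rightarrow> real. inj_on g (topspace Y)"
proof -
  obtain M d where "Metric_space M d" "Y = Metric_space.mtopology M d"
    using assms by (auto simp: Polish_topology_def completely_metrizable_space_def)
  then have "Y = mtopology_of (metric (M, d))"
    by (simp add: mtopology_of_def Metric_space.mspace_metric Metric_space.mdist_metric)
  then show ?thesis
    using separable_metric_inj[of "metric (M,d)"] assms by (simp add: Polish_topology_def)
qed

lemma Urysohn_universal:
  fixes m :: "'b metric"
  assumes U: "Urysohn_space U" and sep: "separable_space (mtopology_of m)"
  shows "\<exists>f. isometry_on (mspace m) m U f"
proof -
  obtain g :: "'b \<Rightarrow> nat \<Rightarrow> real" where g: "inj_on g (mspace m)"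
    using separable_metric_inj[OF sep] by blast
  define h where "h = inv_into (mspace m) g"
  define d where "d = (\<lambda>x y. mdist m (h x) (h y))"
  have hg: "h (g x) = x" if "x \<in> mspace m" for x
    using g that by (simp add: h_def)
  have M: "Metric_space (g ` mspace m) d"
  proof
    fix x y z assume xyz: "x \<in> g ` mspace m" "y \<in> g ` mspace m" "z \<in> g ` mspace m"
    then show "d x z \<le> d x y + d y z"
      by (auto simp: d_def hg mdist_triangle)
  next
    fix x y assume "x \<in> g ` mspace m" "y \<in> g ` mspace m"
    then show "d x y = 0 \<longleftrightarrow> x = y" by (auto simp: d_def hg)
  qed (auto simp: d_def mdist_commute)
  define n where "n = metric (g ` mspace m, d)"
  have n: "mspace n = g ` mspace m" "mdist n = d"
    using M by (simp_all add: n_def Metric_space.mspace_metric Metric_space.mdist_metric)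
  have "Lipschitz_continuous_map m n g"
    unfolding Lipschitz_continuous_map_def by (auto simp: n d_def hg intro!: exI[of _ 1])
  then have "continuous_map (mtopology_of m) (mtopology_of n) g"
    by (intro uniformly_continuous_imp_continuous_map Lipschitz_imp_uniformly_continuous_map)
  then have "separable_space (mtopology_of n)"
    using separable_space_continuous_map_image[of "mtopology_of m" "mtopology_of n" g] sep
    by (simp add: n)
  then obtain f where f: "isometry_on (mspace n) n U f"
    using U unfolding Urysohn_space_def by blast
  have "isometry_on (mspace m) m U (f \<circ> g)"
    using f by (auto simp: isometry_on_def n d_def hg)
  then show ?thesis by blast
qed

lemma complete_K_sigma_reducible:
  fixes Y :: "'b topology"
  assumes E: "complete_K_sigma_equivalence X E" and F: "K_sigma_equivalence Y F"
  shows "Borel_reducible (borel_of Y) F (borel_of X) E"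
proof -
  let ?S = "topspace Y"
  obtain g :: "'b \<Rightarrow> nat \<Rightarrow> real" where g: "inj_on g ?S"
    using Polish_inj F unfolding K_sigma_equivalence_def by blast
  define h where "h = inv_into ?S g"
  have hg: "h (g x) = x" if "x \<in> ?S" for x
    using g that by (simp add: h_def)
  define Z where "Z = pullback_topology (g ` ?S) h Y"
  have topZ: "topspace Z = g ` ?S"
    by (auto simp: Z_def topspace_pullback_topology hg)
  have cg: "continuous_map Y Z g"
    unfolding Z_def
    by (rule continuous_map_pullback') (auto intro: continuous_map_eq[OF continuous_map_id] simp: hg)
  have ch: "continuous_map Z Y h"
    unfolding Z_def using continuous_map_pullback[OF continuous_map_id, of "g ` ?S" h Y] by simp
  have hom: "Y homeomorphic_space Z"
    unfolding homeomorphic_space_def homeomorphic_maps_def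
    using cg ch by (intro exI[of _ g] exI[of _ h]) (auto simp: topZ hg)
  define F' where "F' = map_prod g g ` F"
  have FS: "F \<subseteq> ?S \<times> ?S" and eq: "equiv ?S F"
    using F by (auto simp: K_sigma_equivalence_def equiv_def)
  have F': "(g x, g y) \<in> F' \<longleftrightarrow> (x, y) \<in> F" if "x \<in> ?S" "y \<in> ?S" for x y
  proof
    assume "(g x, g y) \<in> F'"
    then obtain a b where ab: "(a, b) \<in> F" "g x = g a" "g y = g b"
      unfolding F'_def by auto
    then have "a \<in> ?S" "b \<in> ?S" using FS by blast+
    then have "a = x" "b = y" using ab that g by (metis inj_onD)+
    then show "(x, y) \<in> F" using ab by simp
  next
    assume "(x, y) \<in> F"
    then show "(g x, g y) \<in> F'" unfolding F'_def by force
  qed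
  have "Polish_topology Z"
    using F hom homeomorphic_completely_metrizable_space homeomorphic_separable_space
    unfolding K_sigma_equivalence_def Polish_topology_def by blast
  moreover have "equiv (topspace Z) F'"
  proof (rule equivI)
    show sub: "F' \<subseteq> topspace Z \<times> topspace Z" using FS by (auto simp: F'_def topZ)
    show "refl_on (topspace Z) F'"
      unfolding refl_on_def topZ F'_def using eq by (force simp: equiv_def refl_on_def)
    show "sym F'"
    proof (rule symI)
      fix x y assume "(x, y) \<in> F'"
      then obtain a b where "(a, b) \<in> F" "x = g a" "y = g b" unfolding F'_def by auto
      moreover from this have "(b, a) \<in> F" using eq unfolding equiv_def by (blast dest: symD)
      ultimately show "(y, x) \<in> F'" unfolding F'_def by force
    qed
    show "trans F'"
    proof (rule transI)
      fix x y z assume xy: "(x, y) \<in> F'" and yz: "(y, z) \<in> F'"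
      then obtain a b c where "x = g a" "y = g b" "z = g c" "a \<in> ?S" "b \<in> ?S" "c \<in> ?S"
        using sub unfolding topZ by blast
      then show "(x, z) \<in> F'"
        using xy yz F' eq unfolding equiv_def by (metis (no_types) transD)
    qed
  qed
  moreover have "(countable union_of compactin (prod_topology Z Z)) F'"
  proof -
    obtain \<K> where K: "countable \<K>" "\<K> \<subseteq> Collect (compactin (prod_topology Y Y))" "\<Union>\<K> = F"
      using F unfolding K_sigma_equivalence_def union_of_def by blast
    have c: "continuous_map (prod_topology Y Y) (prod_topology Z Z) (map_prod g g)"
      unfolding map_prod_def case_prod_unfold continuous_map_pairwise comp_def fst_conv snd_conv
      using continuous_map_compose[OF continuous_map_fst cg, of Y]
        continuous_map_compose[OF continuous_map_snd cg, of Y]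
      by (simp add: comp_def)
    have "countable ((`) (map_prod g g) ` \<K>)" using K(1) by simp
    moreover have "(`) (map_prod g g) ` \<K> \<subseteq> Collect (compactin (prod_topology Z Z))"
      using K(2) image_compactin[OF _ c] by blast
    moreover have "\<Union>((`) (map_prod g g) ` \<K>) = F'"
      unfolding F'_def K(3)[symmetric] by blast
    ultimately show ?thesis unfolding union_of_def by blast
  qed
  ultimately have "K_sigma_equivalence Z F'" by (simp add: K_sigma_equivalence_def)
  then obtain f where f: "f \<in> measurable (borel_of Z) (borel_of X)"
      "\<forall>x\<in>topspace Z. \<forall>y\<in>topspace Z. (x, y) \<in> F' \<longleftrightarrow> (f x, f y) \<in> E"
    using E unfolding complete_K_sigma_equivalence_def Borel_reducible_def space_borel_of by blast
  have "f \<circ> g \<in> measurable (borel_of Y) (borel_of X)"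
    using continuous_map_borel_of[OF cg] f(1) by (rule measurable_comp)
  moreover have "\<forall>x\<in>?S. \<forall>y\<in>?S. (x, y) \<in> F \<longleftrightarrow> ((f \<circ> g) x, (f \<circ> g) y) \<in> E"
    unfolding comp_def using f(2) F' topZ by blast
  ultimately show ?thesis unfolding Borel_reducible_def space_borel_of by blast
qed

end

(*
  A bi-Lipschitz isomorphism preserves, up to a factor, every statement "some finite tuple of points
  satisfies given upper and lower bounds on its distances, on its density, and on its distances to
  the relations". There are countably many such tests, and recording at which scales 2^L they hold is
  a Borel map into a Cantor space. Two structures are bi-Lipschitz isomorphic iff their codes agree
  up to a bounded shift of L: conversely, tests on finer and finer nets yield approximate
  isomorphisms, and compactness yields an exact one in the limit. Agreement up to a bounded shift is
  a K_sigma equivalence relation.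

  In the other direction, write a K_sigma equivalence relation as an increasing union of compact
  levels D n with D n O D n <= D (n + 1). For a closed set C let h_C(x) be the least n for which x is
  D n-related to a point of C. Two points are equivalent iff h_C(x) - h_C(y) is bounded over a
  countable network of closed sets C_i. The numbers 2^(-h_i(x)) are then encoded by a compact subset
  of a copy of the line in the Urysohn space: at scale 2^(-i) it has a pair of points at distance
  2^(-i) 2^(-h_i(x)), and the relation of arity i + 1 marks this pair.
*)
theory Submission
  imports Defs
begin

text \<open>A net chosen for each structure would have to be chosen in a Borel way; quantifying over
  all finite tuples avoids the choice. The tuple must lie in a carrier that varies with the
  structure, so every test carries a positive safety margin: a nearby tuple of \<open>U\<close> can
  then stand in for it, and the condition becomes open in the Vietoris topology. The margin costs a
  factor 2 in the scale, which the bounded shift absorbs.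

  In the other direction, compactness of the levels is used twice. It makes the sets on which
  \<open>h_C\<close> is at most \<open>n\<close> closed, hence Borel, and it makes the section of a
  level at \<open>y\<close> closed, so that a point \<open>x\<close> outside it has a member of the
  network around it that avoids the section. In the coding structures the arity is a label: an
  isomorphism cannot move a pair to another scale, so its Lipschitz constants compare the
  \<open>i\<close>-th term of one sequence with the \<open>i\<close>-th term of the other. The
  factors \<open>2^(-i)\<close> make the carrier compact and cancel in this comparison.\<close>

section \<open>Limits of approximate isomorphisms\<close>

text \<open>The space it is meant for is a product indexed by all points of two structures, in which
  a sequence need not have a convergent subsequence. A filter below \<open>sequentially\<close>
  takes the place of the subsequence. The point \<open>p\<close> lies in the closures of all tails,
  by the finite intersection property.\<close>

lemma compact_space_cluster_point:
  fixes h :: "nat \<Rightarrow> 'a"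
  assumes X: "compact_space X" and h: "\<And>n. h n \<in> topspace X"
  obtains p G where "G \<noteq> bot" "G \<le> sequentially" "limitin X h p G"
proof -
  define C where "C n = X closure_of (h ` {n..})" for n
  have "\<Inter>(range C) \<noteq> {}"
  proof -
    have "\<Inter>\<F> \<noteq> {}" if fin: "finite \<F>" "\<F> \<subseteq> range C" for \<F>
    proof -
      obtain I where I: "finite I" "\<F> = C ` I"
        using finite_subset_image[OF fin] by auto
      obtain n where n: "\<And>i. i \<in> I \<Longrightarrow> i \<le> n"
        using I(1) finite_nat_set_iff_bounded_le by auto
      have "h n \<in> C i" if "i \<in> I" for i
        unfolding C_def using n[OF that] h by (intro subsetD[OF closure_of_subset]) auto
      then show ?thesis using I(2) by blast
    qed
    then show ?thesis
      using X[unfolded compact_space_fip, rule_format, of "range C"] by (auto simp: C_def)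
  qed
  then obtain p where p: "\<And>n. p \<in> C n" by blast
  have pX: "p \<in> topspace X"
    using p[of 0] unfolding C_def by (simp add: in_closure_of)
  \<comment> \<open>The largest filter below \<open>sequentially\<close> along which
    \<open>h\<close> tends to \<open>p\<close>; it is proper because every neighbourhood of
    \<open>p\<close> meets every tail.\<close>
  define G where "G = inf sequentially (filtercomap h (nhdsin X p))"
  have "G \<noteq> bot"
  proof
    assume "G = bot"
    then have "eventually (\<lambda>_. False) G" by simp
    then obtain P Q where P: "eventually P sequentially"
      and Q: "eventually Q (filtercomap h (nhdsin X p))" and PQ: "\<And>n. P n \<Longrightarrow> Q n \<Longrightarrow> False"
      unfolding G_def eventually_inf by auto
    obtain N where N: "\<And>n. n \<ge> N \<Longrightarrow> P n" using P by (auto simp: eventually_sequentially)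
    obtain V where V: "openin X V" "p \<in> V" "\<And>n. h n \<in> V \<Longrightarrow> Q n"
      using Q pX unfolding eventually_filtercomap eventually_nhdsin by auto
    obtain n where "n \<ge> N" "h n \<in> V"
      using p[of N] V(1,2) unfolding C_def in_closure_of by auto
    then show False by (rule PQ[OF N V(3)])
  qed
  moreover have "G \<le> sequentially" unfolding G_def by simp
  moreover have "limitin X h p G"
    unfolding limitin_def
  proof (intro conjI allI impI)
    fix V assume V: "openin X V \<and> p \<in> V"
    have "eventually (\<lambda>x. x \<in> V) (nhdsin X p)"
      using pX V by (auto simp: eventually_nhdsin)
    then have "eventually (\<lambda>n. h n \<in> V) (filtercomap h (nhdsin X p))"
      by (rule eventually_filtercomapI)
    moreover have "G \<le> filtercomap h (nhdsin X p)" unfolding G_def by simp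
    ultimately show "eventually (\<lambda>n. h n \<in> V) G"
      by (rule filter_leD[rotated])
  qed (use pX in auto)
  ultimately show thesis by (rule that)
qed

lemma limitin_mtopology_of:
  "limitin (mtopology_of m) f l F \<longleftrightarrow>
     l \<in> mspace m \<and> (\<forall>\<epsilon>>0. eventually (\<lambda>x. f x \<in> mspace m \<and> mdist m (f x) l < \<epsilon>) F)"
  by (simp add: mtopology_of_def Metric_space.limitin_metric)

text \<open>The points of \<open>T\<close> close to the tuples \<open>y i\<close> have the same
  coordinatewise limit as these, and convergence in the power is coordinatewise, so closedness of
  \<open>T\<close> applies. The \<open>restrict\<close> is there because the power consists of
  extensional functions.\<close>

lemma closed_relation_limit:
  assumes T: "closedin (power_topology (mtopology_of m) k) T" and G: "G \<noteq> bot"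
    and y: "\<And>j. j < k \<Longrightarrow> limitin (mtopology_of m) (\<lambda>i. y i j) (l j) G"
    and e: "(e \<longlongrightarrow> (0::real)) G"
    and near: "eventually (\<lambda>i. \<exists>w\<in>T. \<forall>j<k. mdist m (y i j) (w j) \<le> e i) G"
  shows "restrict l {..<k} \<in> T"
proof -
  define w where "w i = (SOME w. w \<in> T \<and> (\<forall>j<k. mdist m (y i j) (w j) \<le> e i))" for i
  have w: "eventually (\<lambda>i. w i \<in> T \<and> (\<forall>j<k. mdist m (y i j) (w i j) \<le> e i)) G"
    using near
  proof eventually_elim
    case (elim i)
    then have "\<exists>w. w \<in> T \<and> (\<forall>j<k. mdist m (y i j) (w j) \<le> e i)" by blast
    then show ?case unfolding w_def by (rule someI_ex)
  qed
  have TP: "T \<subseteq> {..<k} \<rightarrow>\<^sub>E mspace m"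
    using closedin_subset[OF T] by simp
  have "limitin (mtopology_of m) (\<lambda>i. w i j) (l j) G" if j: "j < k" for j
    unfolding limitin_mtopology_of
  proof (intro conjI allI impI)
    show l: "l j \<in> mspace m" using y[OF j] unfolding limitin_mtopology_of by simp
    fix \<epsilon> :: real assume "\<epsilon> > 0"
    then have half: "\<epsilon>/2 > 0" by simp
    have 1: "eventually (\<lambda>i. y i j \<in> mspace m \<and> mdist m (y i j) (l j) < \<epsilon>/2) G"
      using y[OF j] half unfolding limitin_mtopology_of by blast
    have 2: "eventually (\<lambda>i. e i < \<epsilon>/2) G"
      using order_tendstoD(2)[OF e half] .
    show "eventually (\<lambda>i. w i j \<in> mspace m \<and> mdist m (w i j) (l j) < \<epsilon>) G"
      using w 1 2
    proof eventually_elim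
      case (elim i)
      then have wm: "w i j \<in> mspace m" using TP j by (auto simp: PiE_iff)
      have "mdist m (w i j) (l j) \<le> mdist m (w i j) (y i j) + mdist m (y i j) (l j)"
        using elim wm l by (intro mdist_triangle) auto
      moreover have "mdist m (y i j) (w i j) \<le> e i" using elim j by blast
      ultimately show ?case using elim wm by (simp add: mdist_commute)
    qed
  qed
  then have "limitin (power_topology (mtopology_of m) k) w (restrict l {..<k}) G"
    unfolding limitin_componentwise
  proof (intro conjI ballI)
    show "eventually (\<lambda>i. w i \<in> topspace (power_topology (mtopology_of m) k)) G"
      using w by eventually_elim (use TP in auto)
  qed auto
  moreover have "eventually (\<lambda>i. w i \<in> T) G"
    using w by eventually_elim simp
  ultimately show ?thesis
    by (rule limitin_closedin[OF _ T _ G])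
qed

text \<open>
  Bounding \<open>d(f x, z)\<close> and \<open>d(x, g z)\<close> by each other, rather than asking for \<open>g (f x)\<close> to be close to
  \<open>x\<close>, gives conditions that pass to pointwise limits of the maps; in the limit, with \<open>e = 0\<close>,
  \<open>z = f x\<close> and \<open>x = g z\<close> show that \<open>f\<close> and \<open>g\<close> are mutually inverse.
\<close>

lemma bi_Lipschitz_isomorphism_limit:
  fixes m :: "'a metric" and n :: "'b metric" and s :: real
  assumes m: "compact_metric_structure m R" and n: "compact_metric_structure n S" and s: "s > 0"
    and approx: "\<And>e. e > 0 \<Longrightarrow> \<exists>f g. f \<in> mspace m \<rightarrow> mspace n \<and> g \<in> mspace n \<rightarrow> mspace m \<and>
      (\<forall>x\<in>mspace m. \<forall>z\<in>mspace n. mdist n (f x) z \<le> s * mdist m x (g z) + e \<and>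
          mdist m x (g z) \<le> s * mdist n (f x) z + e) \<and>
      (\<forall>k\<ge>1. real k \<le> 1/e \<longrightarrow>
         (\<forall>x\<in>R k. \<exists>w\<in>S k. \<forall>j<k. mdist n (f (x j)) (w j) \<le> e) \<and>
         (\<forall>w\<in>S k. \<exists>x\<in>R k. \<forall>j<k. mdist m (g (w j)) (x j) \<le> e))"
  shows "\<exists>\<phi>. bi_Lipschitz_isomorphism m R n S \<phi>"
proof -
  let ?A = "mspace m" and ?B = "mspace n"
  \<comment> \<open>With this choice the arity bound \<open>real k \<le> 1 / e i\<close> reads
    \<open>k \<le> Suc i\<close>, so every fixed arity is controlled from some stage on.\<close>
  define e where "e i = 1 / real (Suc i)" for i
  have e0: "e i > 0" for i by (simp add: e_def)
  have elim: "e \<longlonglongrightarrow> 0"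
    unfolding e_def using LIMSEQ_inverse_real_of_nat by (simp add: inverse_eq_divide)
  define Q where "Q \<epsilon> f g \<longleftrightarrow> f \<in> ?A \<rightarrow> ?B \<and> g \<in> ?B \<rightarrow> ?A \<and>
      (\<forall>x\<in>?A. \<forall>z\<in>?B. mdist n (f x) z \<le> s * mdist m x (g z) + \<epsilon> \<and>
          mdist m x (g z) \<le> s * mdist n (f x) z + \<epsilon>) \<and>
      (\<forall>k\<ge>1. real k \<le> 1/\<epsilon> \<longrightarrow>
         (\<forall>x\<in>R k. \<exists>w\<in>S k. \<forall>j<k. mdist n (f (x j)) (w j) \<le> \<epsilon>) \<and>
         (\<forall>w\<in>S k. \<exists>x\<in>R k. \<forall>j<k. mdist m (g (w j)) (x j) \<le> \<epsilon>))" for \<epsilon> f g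
  have "\<exists>f g. Q (e i) f g" for i
    using approx[OF e0[of i]] unfolding Q_def .
  then obtain F G where FG_Q: "\<And>i. Q (e i) (F i) (G i)" by metis
  have FG: "F i \<in> ?A \<rightarrow> ?B" "G i \<in> ?B \<rightarrow> ?A" for i
    using FG_Q[of i] unfolding Q_def by blast+
  have d: "mdist n (F i x) z \<le> s * mdist m x (G i z) + e i"
      "mdist m x (G i z) \<le> s * mdist n (F i x) z + e i"
    if "x \<in> ?A" "z \<in> ?B" for i x z
    using FG_Q[of i] that unfolding Q_def by blast+
  have k_le: "real k \<le> 1 / e i \<longleftrightarrow> k \<le> Suc i" for k i
    unfolding e_def by (simp del: of_nat_Suc)
  have r: "x \<in> R k \<Longrightarrow> \<exists>w\<in>S k. \<forall>j<k. mdist n (F i (x j)) (w j) \<le> e i"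
      "w \<in> S k \<Longrightarrow> \<exists>x\<in>R k. \<forall>j<k. mdist m (G i (w j)) (x j) \<le> e i"
    if "1 \<le> k" "k \<le> Suc i" for i k x w
    using FG_Q[of i] that unfolding Q_def k_le by blast+
  \<comment> \<open>Both maps together form one point of a product of compact spaces, so a single
    cluster point yields limits of all values along the same filter.\<close>
  define X where "X = prod_topology (product_topology (\<lambda>_. mtopology_of n) ?A)
      (product_topology (\<lambda>_. mtopology_of m) ?B)"
  define h where "h i = (restrict (F i) ?A, restrict (G i) ?B)" for i
  have "compact_space X"
    unfolding X_def using m n
    by (simp add: compact_metric_structure_def compact_space_prod_topology compact_space_product_topology)
  moreover have "h i \<in> topspace X" for i
    using FG unfolding X_def h_def by auto
  ultimately obtain p \<G> where \<G>: "\<G> \<noteq> bot" "\<G> \<le> sequentially" and p: "limitin X h p \<G>"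
    by (rule compact_space_cluster_point)
  obtain f g where fg: "p = (f, g)" by fastforce
  have "limitin (product_topology (\<lambda>_. mtopology_of n) ?A) (\<lambda>i. restrict (F i) ?A) f \<G>"
    and "limitin (product_topology (\<lambda>_. mtopology_of m) ?B) (\<lambda>i. restrict (G i) ?B) g \<G>"
    using p unfolding X_def fg limitin_pairwise h_def by (simp_all add: comp_def)
  then have lim: "\<forall>x\<in>?A. limitin (mtopology_of n) (\<lambda>i. restrict (F i) ?A x) (f x) \<G>"
    "\<forall>z\<in>?B. limitin (mtopology_of m) (\<lambda>i. restrict (G i) ?B z) (g z) \<G>"
    unfolding limitin_componentwise by blast+
  have fl: "limitin (mtopology_of n) (\<lambda>i. F i x) (f x) \<G>" if "x \<in> ?A" for x
    using bspec[OF lim(1) that] that by simp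
  have gl: "limitin (mtopology_of m) (\<lambda>i. G i z) (g z) \<G>" if "z \<in> ?B" for z
    using bspec[OF lim(2) that] that by simp
  have fB: "f x \<in> ?B" if "x \<in> ?A" for x using fl[OF that] by (simp add: limitin_mtopology_of)
  have gA: "g z \<in> ?A" if "z \<in> ?B" for z using gl[OF that] by (simp add: limitin_mtopology_of)
  have el: "(e \<longlongrightarrow> 0) \<G>" using tendsto_mono[OF \<G>(2) elim] .
  have appr: "\<exists>i. mdist n (F i x) (f x) < \<epsilon> \<and> mdist m (G i z) (g z) < \<epsilon> \<and> e i < \<epsilon>"
    if "x \<in> ?A" "z \<in> ?B" "\<epsilon> > 0" for x z \<epsilon>
  proof -
    have "eventually (\<lambda>i. mdist n (F i x) (f x) < \<epsilon> \<and> mdist m (G i z) (g z) < \<epsilon> \<and> e i < \<epsilon>) \<G>"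
      using fl[OF that(1)] gl[OF that(2)] order_tendstoD(2)[OF el that(3)] that(3)
      by (auto simp: limitin_mtopology_of eventually_conj_iff)
    then show ?thesis using \<G>(1) eventually_happens by blast
  qed
  have d1: "mdist n (f x) z \<le> s * mdist m x (g z)" (is "?l \<le> ?r")
    and d2: "mdist m x (g z) \<le> s * mdist n (f x) z" (is "?l' \<le> ?r'")
    if xz: "x \<in> ?A" "z \<in> ?B" for x z
  proof -
    have "?l \<le> ?r + \<epsilon> \<and> ?l' \<le> ?r' + \<epsilon>" if "\<epsilon> > 0" for \<epsilon>
    proof -
      \<comment> \<open>Replacing \<open>G i z\<close> by \<open>g z\<close> (or
        \<open>F i x\<close> by \<open>f x\<close>) under the factor \<open>s\<close> costs
        \<open>s * \<delta>\<close>; the other replacement and the error \<open>e i\<close> cost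
        \<open>\<delta>\<close> each.\<close>
      define \<delta> where "\<delta> = \<epsilon> / (s + 2)"
      have "(s + 2) * \<delta> = \<epsilon>" using s unfolding \<delta>_def by simp
      moreover have "\<delta> > 0" using that s unfolding \<delta>_def by simp
      ultimately have \<delta>: "\<delta> > 0" "s * \<delta> + 2 * \<delta> = \<epsilon>"
        by (auto simp: distrib_right)
      obtain i where i: "mdist n (F i x) (f x) < \<delta>" "mdist m (G i z) (g z) < \<delta>" "e i < \<delta>"
        using appr[OF xz \<delta>(1)] by blast
      have FB: "F i x \<in> ?B" and GA: "G i z \<in> ?A" using FG xz by auto
      have "s * mdist m x (G i z) \<le> s * (mdist m x (g z) + \<delta>)"
        using mdist_triangle[of x m "g z" "G i z"] xz gA GA i s
        by (intro mult_left_mono) (auto simp: mdist_commute)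
      moreover have "?l \<le> mdist n (F i x) (f x) + mdist n (F i x) z"
        using mdist_triangle[of "f x" n "F i x" z] xz fB FB by (simp add: mdist_commute)
      ultimately have 1: "?l \<le> ?r + \<epsilon>" using d(1)[OF xz, of i] i \<delta> by (simp add: algebra_simps)
      have "s * mdist n (F i x) z \<le> s * (mdist n (f x) z + \<delta>)"
        using mdist_triangle[of "F i x" n "f x" z] xz fB FB i s
        by (intro mult_left_mono) (auto simp: mdist_commute)
      moreover have "?l' \<le> mdist m x (G i z) + mdist m (G i z) (g z)"
        using mdist_triangle[of x m "G i z" "g z"] xz gA GA by simp
      ultimately have 2: "?l' \<le> ?r' + \<epsilon>" using d(2)[OF xz, of i] i \<delta> by (simp add: algebra_simps)
      show ?thesis using 1 2 by simp
    qed
    then show "?l \<le> ?r" "?l' \<le> ?r'" by (meson field_le_epsilon)+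
  qed
  have gf: "g (f x) = x" if "x \<in> ?A" for x
  proof -
    have "mdist m x (g (f x)) = 0"
      using d2[OF that fB[OF that]] mdist_zero[OF fB[OF that] fB[OF that]]
      by (intro order.antisym) simp_all
    then show ?thesis using that fB gA by simp
  qed
  have fg': "f (g z) = z" if "z \<in> ?B" for z
  proof -
    have "mdist n (f (g z)) z = 0"
      using d1[OF gA[OF that] that] mdist_zero[OF gA[OF that] gA[OF that]]
      by (intro order.antisym) simp_all
    then show ?thesis using that fB gA by simp
  qed
  have bij: "bij_betw f ?A ?B"
    by (rule bij_betw_byWitness[where f' = g]) (use gf fg' fB gA in auto)
  have inv: "inv_into ?A f z = g z" if "z \<in> ?B" for z
    using inv_into_f_eq[OF bij_betw_imp_inj_on[OF bij] gA[OF that] fg'[OF that]] .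
  have Lf: "Lipschitz_continuous_map m n f"
    unfolding Lipschitz_continuous_map_def
  proof (intro conjI exI ballI)
    show "mdist n (f x) (f y) \<le> s * mdist m x y" if "x \<in> ?A" "y \<in> ?A" for x y
      using d1[OF that(1) fB[OF that(2)]] gf[OF that(2)] by simp
  qed (use fB in auto)
  have "Lipschitz_continuous_map n m g"
    unfolding Lipschitz_continuous_map_def
  proof (intro conjI exI ballI)
    show "mdist m (g y) (g z) \<le> s * mdist n y z" if "y \<in> ?B" "z \<in> ?B" for y z
      using d2[OF gA[OF that(1)] that(2)] fg'[OF that(1)] by simp
  qed (use gA in auto)
  then have Lg: "Lipschitz_continuous_map n m (inv_into ?A f)"
    by (rule Lipschitz_continuous_map_eq) (simp add: inv)
  have RP: "x \<in> {..<k} \<rightarrow>\<^sub>E ?A" if "x \<in> R k" "k \<ge> 1" for x k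
    using m that closedin_subset[of "power_topology (mtopology_of m) k" "R k"]
    by (auto simp: compact_metric_structure_def)
  have SP: "w \<in> {..<k} \<rightarrow>\<^sub>E ?B" if "w \<in> S k" "k \<ge> 1" for w k
    using n that closedin_subset[of "power_topology (mtopology_of n) k" "S k"]
    by (auto simp: compact_metric_structure_def)
  have large: "eventually (\<lambda>i. k \<le> Suc i) \<G>" for k
    by (rule filter_leD[OF \<G>(2)]) (auto simp: eventually_sequentially intro: le_SucI)
  have Rf: "restrict (\<lambda>j. f (x j)) {..<k} \<in> S k" if "k \<ge> 1" "x \<in> R k" for k x
  proof (rule closed_relation_limit[OF _ \<G>(1) _ el])
    show "closedin (power_topology (mtopology_of n) k) (S k)"
      using n that by (simp add: compact_metric_structure_def)
    show "limitin (mtopology_of n) (\<lambda>i. F i (x j)) (f (x j)) \<G>" if "j < k" for j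
      using RP[OF \<open>x \<in> R k\<close>] \<open>k \<ge> 1\<close> that by (intro fl) (auto simp: PiE_iff)
    show "eventually (\<lambda>i. \<exists>w\<in>S k. \<forall>j<k. mdist n (F i (x j)) (w j) \<le> e i) \<G>"
      using large[of k] by eventually_elim (use r(1) that in blast)
  qed
  have Sg: "restrict (\<lambda>j. g (w j)) {..<k} \<in> R k" if "k \<ge> 1" "w \<in> S k" for k w
  proof (rule closed_relation_limit[OF _ \<G>(1) _ el])
    show "closedin (power_topology (mtopology_of m) k) (R k)"
      using m that by (simp add: compact_metric_structure_def)
    show "limitin (mtopology_of m) (\<lambda>i. G i (w j)) (g (w j)) \<G>" if "j < k" for j
      using SP[OF \<open>w \<in> S k\<close>] \<open>k \<ge> 1\<close> that by (intro gl) (auto simp: PiE_iff)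
    show "eventually (\<lambda>i. \<exists>x\<in>R k. \<forall>j<k. mdist m (G i (w j)) (x j) \<le> e i) \<G>"
      using large[of k] by eventually_elim (use r(2) that in blast)
  qed
  have "x \<in> R k \<longleftrightarrow> restrict (f \<circ> x) {..<k} \<in> S k"
    if "k \<ge> 1" "x \<in> {..<k} \<rightarrow>\<^sub>E ?A" for k x
  proof
    assume "restrict (f \<circ> x) {..<k} \<in> S k"
    then have "restrict (\<lambda>j. g (restrict (f \<circ> x) {..<k} j)) {..<k} \<in> R k" using Sg that by blast
    moreover have "restrict (\<lambda>j. g (restrict (f \<circ> x) {..<k} j)) {..<k} = x"
      using that(2) gf by (intro ext) (auto simp: PiE_iff extensional_def restrict_def)
    ultimately show "x \<in> R k" by simp
  qed (use Rf that in \<open>auto simp: comp_def\<close>)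
  then show ?thesis
    using bij Lf Lg unfolding bi_Lipschitz_isomorphism_def by blast
qed

section \<open>Finite tests\<close>

text \<open>Rational bounds and indices into a tuple keep the type countable, so the codes live in a
  countable product. \<open>Near\<close>, \<open>Far\<close> and \<open>Dense\<close> describe a net
  with its distances. \<open>Rel\<close> carries tuples of the relations from the first structure to
  the second; \<open>NRel\<close>, used by contraposition, brings them back.\<close>

datatype test =
    Near nat nat rat
  | Far nat nat rat
  | Dense nat rat
  | Rel "nat list" rat
  | NRel "nat list" rat

instance test :: countable
  by countable_datatype

text \<open>
  The scale \<open>s\<close> is the distortion allowed; \<open>\<eta>\<close> is a safety margin, which makes the tests open
  conditions on the structure. Only positive bounds \<open>q\<close> are allowed, so that they absorb a change of
  the margin. The value at \<open>0\<close> of a family of relations is junk, hence the condition \<open>t \<noteq> []\<close>.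
\<close>

fun holds :: "'a metric \<Rightarrow> (nat \<Rightarrow> (nat \<Rightarrow> 'a) set) \<Rightarrow> real \<Rightarrow> real \<Rightarrow> (nat \<Rightarrow> 'a) \<Rightarrow> test \<Rightarrow> bool" where
  "holds m R \<eta> s x (Near a b q) \<longleftrightarrow> mdist m (x a) (x b) + 2 * \<eta> < s * of_rat q"
| "holds m R \<eta> s x (Far a b q) \<longleftrightarrow> 0 < q \<and> of_rat q < s * (mdist m (x a) (x b) - 2 * \<eta>)"
| "holds m R \<eta> s x (Dense n q) \<longleftrightarrow> 0 < q \<and> (\<forall>z\<in>mspace m. \<exists>a<n. mdist m z (x a) + \<eta> < s * of_rat q)"
| "holds m R \<eta> s x (Rel t q) \<longleftrightarrow> t \<noteq> [] \<and> 0 < q \<and>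
     (\<exists>z\<in>R (length t). \<forall>j<length t. mdist m (z j) (x (t ! j)) + \<eta> < s * of_rat q)"
| "holds m R \<eta> s x (NRel t q) \<longleftrightarrow> t \<noteq> [] \<and> 0 < q \<and>
     (\<forall>z\<in>R (length t). \<exists>j<length t. of_rat q < s * (mdist m (z j) (x (t ! j)) - \<eta>))"

text \<open>The index is reduced modulo the length to keep every point of the tuple inside the structure.\<close>

definition pt :: "'a list \<Rightarrow> nat \<Rightarrow> 'a" where
  "pt xs a = xs ! (a mod length xs)"

text \<open>One tuple and one margin must serve the whole list, since the tests of a list jointly
  describe one net. As the tuple is nonempty, even the empty list carries information: it tells
  empty carriers from nonempty ones.\<close>

definition passes :: "'a metric \<Rightarrow> (nat \<Rightarrow> (nat \<Rightarrow> 'a) set) \<Rightarrow> test list \<Rightarrow> real \<Rightarrow> bool" where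
  "passes m R ts s \<longleftrightarrow> (\<exists>\<eta>>0. \<exists>xs. xs \<noteq> [] \<and> set xs \<subseteq> mspace m \<and>
     (\<forall>\<tau>\<in>set ts. holds m R \<eta> s (pt xs) \<tau>))"

lemma pt_in_set: "xs \<noteq> [] \<Longrightarrow> pt xs a \<in> set xs"
  by (simp add: pt_def)

lemma pt_map: "xs \<noteq> [] \<Longrightarrow> pt (map f xs) a = f (pt xs a)"
  by (simp add: pt_def)

lemma pt_nth: "a < length xs \<Longrightarrow> pt xs a = xs ! a"
  by (simp add: pt_def)

lemma holds_antimono:
  assumes "holds m R \<eta> s x \<tau>" "\<delta> \<le> \<eta>" "s > 0"
  shows "holds m R \<delta> s x \<tau>"
proof -
  have *: "s * (d - \<eta>) \<le> s * (d - \<delta>)" "s * (d - 2 * \<eta>) \<le> s * (d - 2 * \<delta>)" for d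
    using assms by (simp_all add: mult_left_mono)
  show ?thesis
  proof (cases \<tau>)
    case (Dense n q)
    then show ?thesis using assms(1,2) by simp (meson add_left_mono le_less_trans)
  next
    case (Rel t q)
    then show ?thesis using assms(1,2) by simp (meson add_left_mono le_less_trans)
  next
    case (NRel t q)
    then show ?thesis using assms(1) * by simp (meson less_le_trans)
  qed (use assms(1,2) * in \<open>auto intro: less_le_trans\<close>)
qed

text \<open>Moving every point of the tuple by at most \<open>\<delta>\<close> changes the distance
  between two of them by up to twice \<open>\<delta>\<close>, but the distance to a point of the
  structure only by \<open>\<delta>\<close>. This is why the margin enters \<open>Near\<close> and
  \<open>Far\<close> doubled.\<close>

lemma holds_perturb:
  assumes h: "holds (submetric U M) R (\<eta> + \<delta>) s x \<tau>" and s: "s > 0"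
    and M: "M \<subseteq> mspace U" and R: "\<And>k. k \<ge> 1 \<Longrightarrow> R k \<subseteq> {..<k} \<rightarrow>\<^sub>E M"
    and x: "\<And>a. x a \<in> mspace U" and y: "\<And>a. y a \<in> mspace U"
    and xy: "\<And>a. mdist U (x a) (y a) \<le> \<delta>"
  shows "holds (submetric U M) R \<eta> s y \<tau>"
proof -
  have tri: "mdist U z (y a) \<le> mdist U z (x a) + \<delta>" "mdist U z (x a) - \<delta> \<le> mdist U z (y a)"
    if "z \<in> mspace U" for z a
    using mdist_triangle[OF that x y, of a a] mdist_triangle[OF that y x, of a a] xy[of a]
    by (auto simp: mdist_commute)
  have yx: "mdist U (y a) (x b) \<le> mdist U (x a) (x b) + \<delta>"
    "mdist U (x a) (x b) - \<delta> \<le> mdist U (y a) (x b)" for a b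
    using tri[OF x, of b a] by (simp_all add: mdist_commute)
  have tri2: "mdist U (y a) (y b) \<le> mdist U (x a) (x b) + 2 * \<delta>"
    "mdist U (x a) (x b) - 2 * \<delta> \<le> mdist U (y a) (y b)" for a b
    using tri[OF y, of a b] yx[of a b] by auto
  have Rin: "z j \<in> mspace U" if "z \<in> R k" "j < k" for z j k
    using R[of k] M that by (auto simp: PiE_iff subset_iff)
  show ?thesis
  proof (cases \<tau>)
    case (Near a b q)
    then show ?thesis using h tri2(1)[of a b] by simp
  next
    case (Far a b q)
    have "s * (mdist U (x a) (x b) - 2 * (\<eta> + \<delta>)) \<le> s * (mdist U (y a) (y b) - 2 * \<eta>)"
      using tri2(2)[of a b] s by (intro mult_left_mono) auto
    then show ?thesis using h Far by simp
  next
    case (Dense n q)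
    have "mdist U z (y a) + \<eta> < s * of_rat q"
      if "z \<in> M" "mdist U z (x a) + (\<eta> + \<delta>) < s * of_rat q" for z a
      using tri(1)[of z a] that M by auto
    then show ?thesis using h Dense M by auto blast
  next
    case (Rel t q)
    then obtain z where z: "z \<in> R (length t)"
      "\<forall>j<length t. mdist U (z j) (x (t ! j)) + (\<eta> + \<delta>) < s * of_rat q"
      using h by auto
    have "\<forall>j<length t. mdist U (z j) (y (t ! j)) + \<eta> < s * of_rat q"
      using z(2) tri(1)[OF Rin[OF z(1)]] by (smt (verit))
    then show ?thesis using h Rel z(1) by auto
  next
    case (NRel t q)
    have "\<exists>j<length t. of_rat q < s * (mdist U (z j) (y (t ! j)) - \<eta>)" if z: "z \<in> R (length t)" for z
    proof -
      obtain j where j: "j < length t" "of_rat q < s * (mdist U (z j) (x (t ! j)) - (\<eta> + \<delta>))"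
        using h NRel z by auto
      have "s * (mdist U (z j) (x (t ! j)) - (\<eta> + \<delta>)) \<le> s * (mdist U (z j) (y (t ! j)) - \<eta>)"
        using tri(2)[OF Rin[OF z j(1)], of "t ! j"] s by (intro mult_left_mono) auto
      then show ?thesis using j by (meson less_le_trans)
    qed
    then show ?thesis using h NRel by simp
  qed
qed

text \<open>Doubling the scale doubles the room allowed by a positive bound \<open>q\<close>. For
  upper bounds the gain is \<open>s * q\<close>, which is split in two for \<open>Near\<close>; for
  lower bounds the gain is \<open>q\<close>, which after division by the scale \<open>2 * s\<close>
  leaves \<open>q / (2 * s)\<close>, again halved for \<open>Far\<close>.\<close>

lemma holds_slack:
  assumes h: "holds m R 0 s x \<tau>" and s: "s > 0"
  shows "\<exists>\<eta>>0. holds m R \<eta> (2 * s) x \<tau>"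
proof (cases \<tau>)
  case (Near a b q)
  then have 1: "mdist m (x a) (x b) < s * of_rat q" using h by simp
  have 2: "0 < s * real_of_rat q" using 1 mdist_nonneg[of m "x a" "x b"] by linarith
  show ?thesis
    unfolding Near by (rule exI[of _ "s * of_rat q / 2"]) (use 1 2 in auto)
next
  case (Far a b q)
  then have q: "0 < q" "of_rat q < s * mdist m (x a) (x b)" using h by simp_all
  have "of_rat q < 2 * s * (mdist m (x a) (x b) - 2 * (of_rat q / (4 * s)))"
    using q s by (simp add: algebra_simps)
  then show ?thesis using q s unfolding Far
    by (intro exI[of _ "of_rat q / (4 * s)"]) auto
next
  case (Dense n q)
  then have q: "0 < q" and z: "\<forall>z\<in>mspace m. \<exists>a<n. mdist m z (x a) < s * of_rat q" using h by simp_all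
  have "\<forall>z\<in>mspace m. \<exists>a<n. mdist m z (x a) + s * of_rat q < 2 * s * of_rat q"
    using z by fastforce
  then show ?thesis using q s unfolding Dense
    by (intro exI[of _ "s * of_rat q"]) auto
next
  case (Rel t q)
  then have q: "0 < q" "t \<noteq> []"
    and z: "\<exists>z\<in>R (length t). \<forall>j<length t. mdist m (z j) (x (t ! j)) < s * of_rat q" using h by simp_all
  have "\<exists>z\<in>R (length t). \<forall>j<length t. mdist m (z j) (x (t ! j)) + s * of_rat q < 2 * s * of_rat q"
    using z by fastforce
  then show ?thesis using q s unfolding Rel
    by (intro exI[of _ "s * of_rat q"]) auto
next
  case (NRel t q)
  then have q: "0 < q" "t \<noteq> []"
    and z: "\<And>z. z \<in> R (length t) \<Longrightarrow> \<exists>j<length t. of_rat q < s * mdist m (z j) (x (t ! j))"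
    using h by simp_all
  have "of_rat q < 2 * s * (d - of_rat q / (2 * s))" if "of_rat q < s * d" for d :: real
    using that s by (simp add: algebra_simps)
  then have "\<exists>j<length t. of_rat q < 2 * s * (mdist m (z j) (x (t ! j)) - of_rat q / (2 * s))"
    if "z \<in> R (length t)" for z
    using z[OF that] by blast
  then show ?thesis using q s unfolding NRel
    by (intro exI[of _ "of_rat q / (2 * s)"]) auto
qed

text \<open>Finitely many tests need finitely many margins, and the smallest one serves all of them.
  Tests that are true at scale 1 without margin are thus passed at scale 2, the scale at which codes
  are compared later.\<close>

lemma passes_slack:
  assumes xs: "xs \<noteq> []" "set xs \<subseteq> mspace m" and s: "s > 0"
    and h: "\<And>\<tau>. \<tau> \<in> set ts \<Longrightarrow> holds m R 0 s (pt xs) \<tau>"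
  shows "passes m R ts (2 * s)"
proof -
  have "\<exists>\<eta>>0. \<forall>\<tau>\<in>set ts. holds m R \<eta> (2 * s) (pt xs) \<tau>"
    using h
  proof (induction ts)
    case Nil
    show ?case by (rule exI[of _ 1]) simp
  next
    case (Cons t ts)
    obtain \<eta> where \<eta>: "\<eta> > 0" "\<forall>\<tau>\<in>set ts. holds m R \<eta> (2 * s) (pt xs) \<tau>"
      using Cons by auto
    obtain \<delta> where \<delta>: "\<delta> > 0" "holds m R \<delta> (2 * s) (pt xs) t"
      using holds_slack[OF Cons.prems[of t] s] by auto
    show ?case
      by (rule exI[of _ "min \<eta> \<delta>"]) (use \<eta> \<delta> s in \<open>auto intro: holds_antimono\<close>)
  qed
  then show ?thesis using xs unfolding passes_def by blast
qed

section \<open>Behaviour of the tests under isomorphisms\<close>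

lemma bi_Lipschitz_isomorphism_scale:
  assumes "bi_Lipschitz_isomorphism m R n S \<phi>"
  obtains c :: nat where
    "\<And>x y. x \<in> mspace m \<Longrightarrow> y \<in> mspace m \<Longrightarrow> mdist n (\<phi> x) (\<phi> y) \<le> 2 ^ c * mdist m x y"
    "\<And>x y. x \<in> mspace m \<Longrightarrow> y \<in> mspace m \<Longrightarrow> mdist m x y \<le> 2 ^ c * mdist n (\<phi> x) (\<phi> y)"
proof -
  let ?i = "inv_into (mspace m) \<phi>"
  have bij: "bij_betw \<phi> (mspace m) (mspace n)" and "Lipschitz_continuous_map m n \<phi>"
    and "Lipschitz_continuous_map n m ?i"
    using assms unfolding bi_Lipschitz_isomorphism_def by blast+
  then obtain A B where "\<forall>x\<in>mspace m. \<forall>y\<in>mspace m. mdist n (\<phi> x) (\<phi> y) \<le> A * mdist m x y"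
    and "\<forall>x\<in>mspace n. \<forall>y\<in>mspace n. mdist m (?i x) (?i y) \<le> B * mdist n x y"
    unfolding Lipschitz_continuous_map_def by blast
  then have A: "\<And>x y. x \<in> mspace m \<Longrightarrow> y \<in> mspace m \<Longrightarrow> mdist n (\<phi> x) (\<phi> y) \<le> A * mdist m x y"
    and B: "\<And>x y. x \<in> mspace n \<Longrightarrow> y \<in> mspace n \<Longrightarrow> mdist m (?i x) (?i y) \<le> B * mdist n x y"
    by blast+
  obtain c where c: "max A B < 2 ^ c"
    using real_arch_pow[of 2 "max A B"] by auto
  show thesis
  proof (rule that[of c])
    fix x y assume xy: "x \<in> mspace m" "y \<in> mspace m"
    have "A * mdist m x y \<le> 2 ^ c * mdist m x y"
      using c by (intro mult_right_mono) auto
    then show "mdist n (\<phi> x) (\<phi> y) \<le> 2 ^ c * mdist m x y" using A[OF xy] by linarith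
    have \<phi>: "\<phi> x \<in> mspace n" "\<phi> y \<in> mspace n" "?i (\<phi> x) = x" "?i (\<phi> y) = y"
      using bij xy by (auto simp: bij_betw_def)
    have "B * mdist n (\<phi> x) (\<phi> y) \<le> 2 ^ c * mdist n (\<phi> x) (\<phi> y)"
      using c by (intro mult_right_mono) auto
    then show "mdist m x y \<le> 2 ^ c * mdist n (\<phi> x) (\<phi> y)"
      using B[OF \<phi>(1,2)] \<phi>(3,4) by simp
  qed
qed

text \<open>The image of a tuple under \<open>\<phi>\<close> passes the same tests with the scale
  multiplied by \<open>K\<close>, at the price of a smaller margin. Tuples of the relations are
  pushed forward for \<open>Rel\<close> and pulled back for \<open>NRel\<close>.\<close>

lemma passes_bi_Lipschitz:
  assumes iso: "bi_Lipschitz_isomorphism m R n S \<phi>" and K: "K \<ge> 1" and s: "s > 0"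
    and R: "\<And>k. k \<ge> 1 \<Longrightarrow> R k \<subseteq> {..<k} \<rightarrow>\<^sub>E mspace m"
    and S: "\<And>k. k \<ge> 1 \<Longrightarrow> S k \<subseteq> {..<k} \<rightarrow>\<^sub>E mspace n"
    and up: "\<And>x y. x \<in> mspace m \<Longrightarrow> y \<in> mspace m \<Longrightarrow> mdist n (\<phi> x) (\<phi> y) \<le> K * mdist m x y"
    and lo: "\<And>x y. x \<in> mspace m \<Longrightarrow> y \<in> mspace m \<Longrightarrow> mdist m x y \<le> K * mdist n (\<phi> x) (\<phi> y)"
    and p: "passes m R ts s"
  shows "passes n S ts (K * s)"
proof -
  obtain \<eta> xs where \<eta>: "\<eta> > 0" and xs: "xs \<noteq> []" "set xs \<subseteq> mspace m"
    and h: "\<And>\<tau>. \<tau> \<in> set ts \<Longrightarrow> holds m R \<eta> s (pt xs) \<tau>"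
    using p unfolding passes_def by blast
  have bij: "bij_betw \<phi> (mspace m) (mspace n)"
    and RS: "\<And>k x. k \<ge> 1 \<Longrightarrow> x \<in> {..<k} \<rightarrow>\<^sub>E mspace m \<Longrightarrow> x \<in> R k \<longleftrightarrow> restrict (\<phi> \<circ> x) {..<k} \<in> S k"
    using iso unfolding bi_Lipschitz_isomorphism_def by blast+
  define y where "y = pt (map \<phi> xs)"
  have y: "y a = \<phi> (pt xs a)" for a unfolding y_def using xs(1) by (simp add: pt_map)
  have x: "pt xs a \<in> mspace m" for a using pt_in_set[OF xs(1)] xs(2) by blast
  \<comment> \<open>Lower bounds on distances are divided by \<open>K\<close>, and their margin with
    them, hence \<open>K * \<delta> = \<eta>\<close>. Upper bounds would allow the margin
    \<open>K * \<eta>\<close>, which is at least \<open>\<delta>\<close> because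
    \<open>K \<ge> 1\<close>.\<close>
  define \<delta> where "\<delta> = \<eta> / K"
  have \<delta>: "\<delta> > 0" "K * \<delta> = \<eta>" "\<delta> \<le> K * \<eta>"
  proof -
    show "\<delta> > 0" "K * \<delta> = \<eta>" using K \<eta> by (auto simp: \<delta>_def)
    have "\<eta> / K \<le> \<eta>" "\<eta> \<le> K * \<eta>" using K \<eta> by (simp_all add: field_simps)
    then show "\<delta> \<le> K * \<eta>" unfolding \<delta>_def by linarith
  qed
  have up': "mdist n (\<phi> u) (\<phi> v) + \<delta> < K * s * q" if "u \<in> mspace m" "v \<in> mspace m" "mdist m u v + \<eta> < s * q" for u v q
  proof -
    have "K * (mdist m u v + \<eta>) < K * (s * q)" using that(3) K by simp
    then show ?thesis using up[OF that(1,2)] \<delta>(3) by (simp add: algebra_simps)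
  qed
  have lo': "q < K * s * (mdist n (\<phi> u) (\<phi> v) - \<delta>)" if "u \<in> mspace m" "v \<in> mspace m" "q < s * (mdist m u v - \<eta>)" for u v q
  proof -
    have "s * (mdist m u v - \<eta>) \<le> s * (K * mdist n (\<phi> u) (\<phi> v) - K * \<delta>)"
      using lo[OF that(1,2)] s \<delta>(2) by (intro mult_left_mono) auto
    then show ?thesis using that(3) by (simp add: algebra_simps)
  qed
  have "holds n S \<delta> (K * s) y \<tau>" if \<tau>: "\<tau> \<in> set ts" for \<tau>
  proof (cases \<tau>)
    case (Near a b q)
    have "K * (mdist m (pt xs a) (pt xs b) + 2 * \<eta>) < K * (s * of_rat q)" using h[OF \<tau>] Near K by simp
    then show ?thesis
      using up[OF x x, of a b] \<delta>(3) unfolding Near by (simp add: y algebra_simps)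
  next
    case (Far a b q)
    have "s * (mdist m (pt xs a) (pt xs b) - 2 * \<eta>) \<le> s * (K * mdist n (y a) (y b) - 2 * (K * \<delta>))"
      using lo[OF x x, of a b] s \<delta>(2) by (intro mult_left_mono) (auto simp: y)
    then show ?thesis
      using h[OF \<tau>] unfolding Far by (simp add: algebra_simps)
  next
    case (Dense k q)
    have "\<exists>a<k. mdist n z (y a) + \<delta> < K * s * of_rat q" if z: "z \<in> mspace n" for z
    proof -
      obtain u where u: "u \<in> mspace m" "z = \<phi> u" using bij z by (auto simp: bij_betw_def)
      then obtain a where "a < k" "mdist m u (pt xs a) + \<eta> < s * of_rat q"
        using h[OF \<tau>] Dense by auto
      then show ?thesis using up'[OF u(1) x] u(2) y by auto
    qed
    then show ?thesis using h[OF \<tau>] Dense by simp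
  next
    case (Rel t q)
    let ?k = "length t"
    have k: "?k \<ge> 1" and q: "0 < q" using h[OF \<tau>] Rel by (cases t; simp)+
    obtain z where z: "z \<in> R ?k" "\<forall>j<?k. mdist m (z j) (pt xs (t ! j)) + \<eta> < s * of_rat q"
      using h[OF \<tau>] Rel by auto
    have zP: "z \<in> {..<?k} \<rightarrow>\<^sub>E mspace m" using R[OF k] z(1) by blast
    have "restrict (\<phi> \<circ> z) {..<?k} \<in> S ?k" using RS[OF k zP] z(1) by blast
    moreover have "\<forall>j<?k. mdist n (restrict (\<phi> \<circ> z) {..<?k} j) (y (t ! j)) + \<delta> < K * s * of_rat q"
      using up'[OF _ x] z(2) zP by (auto simp: y PiE_iff)
    ultimately have "\<exists>w\<in>S ?k. \<forall>j<?k. mdist n (w j) (y (t ! j)) + \<delta> < K * s * of_rat q"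
      by (intro bexI[where x = "restrict (\<phi> \<circ> z) {..<?k}"])
    then show ?thesis using k q unfolding Rel by auto
  next
    case (NRel t q)
    let ?k = "length t"
    have k: "?k \<ge> 1" and q: "0 < q" using h[OF \<tau>] NRel by (cases t; simp)+
    have "\<exists>j<?k. of_rat q < K * s * (mdist n (w j) (y (t ! j)) - \<delta>)" if w: "w \<in> S ?k" for w
    proof -
      define z where "z = restrict (inv_into (mspace m) \<phi> \<circ> w) {..<?k}"
      have wP: "w \<in> {..<?k} \<rightarrow>\<^sub>E mspace n" using S[OF k] w by blast
      have zj: "z j \<in> mspace m" "\<phi> (z j) = w j" if "j < ?k" for j
      proof -
        have "w j \<in> \<phi> ` mspace m" using wP that bij by (auto simp: bij_betw_def PiE_iff)
        then show "z j \<in> mspace m" "\<phi> (z j) = w j"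
          using that unfolding z_def by (auto intro: inv_into_into f_inv_into_f)
      qed
      have "restrict (\<phi> \<circ> z) {..<?k} = w"
        using zj(2) wP by (intro ext) (auto simp: PiE_iff extensional_def)
      moreover have "z \<in> {..<?k} \<rightarrow>\<^sub>E mspace m"
        using zj(1) unfolding z_def by auto
      ultimately have "z \<in> R ?k" using RS[OF k] w by simp
      then obtain j where "j < ?k" "of_rat q < s * (mdist m (z j) (pt xs (t ! j)) - \<eta>)"
        using h[OF \<tau>] NRel by auto
      then show ?thesis using lo'[OF zj(1) x] zj(2) y by auto
    qed
    then show ?thesis using k q unfolding NRel by auto
  qed
  moreover have "map \<phi> xs \<noteq> []" "set (map \<phi> xs) \<subseteq> mspace n"
    using xs bij by (auto simp: bij_betw_def)
  ultimately show ?thesis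
    unfolding passes_def y_def using \<delta>(1) by blast
qed

section \<open>The tests are open conditions in the Vietoris topology\<close>

lemma openin_Vietoris_subset:
  assumes "openin X V" shows "openin (Vietoris_topology X) {K. compactin X K \<and> K \<subseteq> V}"
  unfolding Vietoris_topology_def by (rule topology_generated_by_Basis) (use assms in blast)

lemma openin_Vietoris_meets:
  assumes "openin X V" shows "openin (Vietoris_topology X) {K. compactin X K \<and> K \<inter> V \<noteq> {}}"
  unfolding Vietoris_topology_def by (rule topology_generated_by_Basis) (use assms in blast)

lemma openin_preimage_Vietoris:
  assumes f: "continuous_map T (Vietoris_topology X) f" and V: "openin X V"
  shows "openin T {p \<in> topspace T. f p \<subseteq> V}" "openin T {p \<in> topspace T. f p \<inter> V \<noteq> {}}"
proof -
  have c: "compactin X (f p)" if "p \<in> topspace T" for p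
    using f that by (auto simp: continuous_map_def topspace_Vietoris)
  have "{p \<in> topspace T. f p \<in> {K. compactin X K \<and> K \<subseteq> V}} = {p \<in> topspace T. f p \<subseteq> V}"
    "{p \<in> topspace T. f p \<in> {K. compactin X K \<and> K \<inter> V \<noteq> {}}} = {p \<in> topspace T. f p \<inter> V \<noteq> {}}"
    using c by auto
  then show "openin T {p \<in> topspace T. f p \<subseteq> V}" "openin T {p \<in> topspace T. f p \<inter> V \<noteq> {}}"
    using openin_continuous_map_preimage[OF f openin_Vietoris_subset[OF V]]
      openin_continuous_map_preimage[OF f openin_Vietoris_meets[OF V]] by simp_all
qed

lemma continuous_map_carrier:
  "continuous_map (structure_topology U) (Vietoris_topology (mtopology_of U)) fst"
  unfolding structure_topology_def by (intro continuous_map_from_subtopology continuous_map_fst)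

lemma continuous_map_relation:
  assumes "k \<ge> 1"
  shows "continuous_map (structure_topology U)
    (Vietoris_topology (power_topology (mtopology_of U) k)) (\<lambda>p. snd p k)"
proof -
  let ?P = "product_topology (\<lambda>k. Vietoris_topology (power_topology (mtopology_of U) k)) {1..}"
  have "continuous_map (structure_topology U) ?P snd"
    unfolding structure_topology_def by (intro continuous_map_from_subtopology continuous_map_snd)
  moreover have "continuous_map ?P (Vietoris_topology (power_topology (mtopology_of U) k)) (\<lambda>x. x k)"
    using assms by (intro continuous_map_product_projection) simp
  ultimately show ?thesis
    using continuous_map_compose by (fastforce simp: comp_def)
qed


lemma structure_codesD:
  assumes "(M, R) \<in> structure_codes U"
  shows "M \<subseteq> mspace U" "mspace (submetric U M) = M" "compact_metric_structure (submetric U M) R"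
    "\<And>k. k \<ge> 1 \<Longrightarrow> R k \<subseteq> {..<k} \<rightarrow>\<^sub>E M"
proof -
  show M: "M \<subseteq> mspace U" and c: "compact_metric_structure (submetric U M) R"
    using assms by (auto simp: structure_codes_def)
  then show *: "mspace (submetric U M) = M" by auto
  show "R k \<subseteq> {..<k} \<rightarrow>\<^sub>E M" if "k \<ge> 1" for k
    using c that closedin_subset[of "power_topology (mtopology_of (submetric U M)) k" "R k"] *
    by (simp add: compact_metric_structure_def)
qed

text \<open>The tuple is fixed in \<open>U\<close> and need not lie in the structure. Then
  \<open>Near\<close> and \<open>Far\<close> do not depend on the structure at all,
  \<open>Dense\<close> puts the carrier inside a finite union of open balls, \<open>Rel\<close> lets
  a relation meet an open box, and \<open>NRel\<close> puts a relation inside the complement of a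
  closed box.\<close>

lemma openin_holds:
  assumes x: "\<And>a. x a \<in> mspace U" and s: "s > 0"
  shows "openin (structure_topology U)
    {p \<in> structure_codes U. holds (submetric U (fst p)) (snd p) \<eta> s x \<tau>}"
proof -
  interpret Metric_space "mspace U" "mdist U" by simp
  let ?T = "structure_topology U"
  have T: "topspace ?T = structure_codes U" by (rule topspace_structure_topology)
  have const: "openin ?T {p \<in> structure_codes U. P}" for P
    using openin_topspace[of ?T] unfolding T by (cases P) auto
  have code: "fst p \<subseteq> mspace U" "\<And>k. k \<ge> 1 \<Longrightarrow> snd p k \<subseteq> {..<k} \<rightarrow>\<^sub>E mspace U"
    if "p \<in> structure_codes U" for p
  proof -
    have "(fst p, snd p) \<in> structure_codes U" using that by simp
    note c = structure_codesD[OF this]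
    show "fst p \<subseteq> mspace U" by (rule c(1))
    show "snd p k \<subseteq> {..<k} \<rightarrow>\<^sub>E mspace U" if "k \<ge> 1" for k
      using c(4)[OF that] PiE_mono[of "{..<k}" "\<lambda>_. fst p" "\<lambda>_. mspace U"] c(1) by blast
  qed
  show ?thesis
  proof (cases \<tau>)
    case (Near a b q)
    show ?thesis unfolding Near holds.simps mdist_submetric by (rule const)
  next
    case (Far a b q)
    show ?thesis unfolding Far holds.simps mdist_submetric by (rule const)
  next
    case (Dense n q)
    define V where "V = (\<Union>a<n. mball (x a) (s * of_rat q - \<eta>))"
    have "openin (mtopology_of U) V" unfolding mtopology_of_def V_def by auto
    then have "openin ?T {p \<in> topspace ?T. fst p \<subseteq> V}"
      by (rule openin_preimage_Vietoris(1)[OF continuous_map_carrier])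
    moreover have "(\<forall>z\<in>mspace (submetric U (fst p)). \<exists>a<n. mdist U z (x a) + \<eta> < s * of_rat q)
        \<longleftrightarrow> fst p \<subseteq> V" if "p \<in> structure_codes U" for p
    proof -
      have "z \<in> V \<longleftrightarrow> (\<exists>a<n. mdist U z (x a) + \<eta> < s * of_rat q)" if "z \<in> mspace U" for z
        using that x unfolding V_def by (auto simp: mdist_commute less_diff_eq)
      then show ?thesis using code(1)[OF that] by auto
    qed
    then have "{p \<in> structure_codes U. holds (submetric U (fst p)) (snd p) \<eta> s x \<tau>} =
        {p \<in> structure_codes U. 0 < q} \<inter> {p \<in> topspace ?T. fst p \<subseteq> V}"
      unfolding T Dense by auto
    ultimately show ?thesis by (simp only: openin_Int[OF const])
  next
    case (Rel t q)
    let ?k = "length t"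
    define V where "V = (\<Pi>\<^sub>E j\<in>{..<?k}. mball (x (t ! j)) (s * of_rat q - \<eta>))"
    have V: "openin (power_topology (mtopology_of U) ?k) V"
      unfolding V_def openin_PiE_gen by (auto simp: mtopology_of_def)
    show ?thesis
    proof (cases "t = []")
      case False
      then have k: "?k \<ge> 1" by (cases t) auto
      have "openin ?T {p \<in> topspace ?T. snd p ?k \<inter> V \<noteq> {}}"
        by (rule openin_preimage_Vietoris(2)[OF continuous_map_relation[OF k] V])
      moreover have "(\<exists>z\<in>snd p ?k. \<forall>j<?k. mdist U (z j) (x (t ! j)) + \<eta> < s * of_rat q)
        \<longleftrightarrow> snd p ?k \<inter> V \<noteq> {}" if "p \<in> structure_codes U" for p
      proof -
        have "z \<in> V \<longleftrightarrow> (\<forall>j<?k. mdist U (z j) (x (t ! j)) + \<eta> < s * of_rat q)"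
          if "z \<in> {..<?k} \<rightarrow>\<^sub>E mspace U" for z
          using that x unfolding V_def by (auto simp: PiE_iff mdist_commute less_diff_eq)
        then show ?thesis using code(2)[OF that k] by blast
      qed
      then have "{p \<in> structure_codes U. holds (submetric U (fst p)) (snd p) \<eta> s x \<tau>} =
          {p \<in> structure_codes U. 0 < q} \<inter> {p \<in> topspace ?T. snd p ?k \<inter> V \<noteq> {}}"
        unfolding T Rel using False by auto
      ultimately show ?thesis by (simp only: openin_Int[OF const])
    qed (simp add: Rel)
  next
    case (NRel t q)
    let ?k = "length t"
    define C where "C = (\<Pi>\<^sub>E j\<in>{..<?k}. mcball (x (t ! j)) (of_rat q / s + \<eta>))"
    define V where "V = ({..<?k} \<rightarrow>\<^sub>E mspace U) - C"
    have "closedin (power_topology (mtopology_of U) ?k) C"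
      unfolding C_def closedin_product_topology by (simp add: mtopology_of_def)
    then have V: "openin (power_topology (mtopology_of U) ?k) V"
      unfolding V_def by (simp add: closedin_def)
    show ?thesis
    proof (cases "t = []")
      case False
      then have k: "?k \<ge> 1" by (cases t) auto
      have "openin ?T {p \<in> topspace ?T. snd p ?k \<subseteq> V}"
        by (rule openin_preimage_Vietoris(1)[OF continuous_map_relation[OF k] V])
      moreover have "(\<forall>z\<in>snd p ?k. \<exists>j<?k. of_rat q < s * (mdist U (z j) (x (t ! j)) - \<eta>))
        \<longleftrightarrow> snd p ?k \<subseteq> V" if "p \<in> structure_codes U" for p
      proof -
        have far: "of_rat q < s * (d - \<eta>) \<longleftrightarrow> \<not> d \<le> of_rat q / s + \<eta>" for d :: real
          using s by (auto simp: field_simps)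
        have "z \<in> V \<longleftrightarrow> (\<exists>j<?k. of_rat q < s * (mdist U (z j) (x (t ! j)) - \<eta>))"
          if "z \<in> {..<?k} \<rightarrow>\<^sub>E mspace U" for z
          using that x unfolding V_def C_def far by (auto simp: PiE_iff mdist_commute)
        then show ?thesis using code(2)[OF that k] by blast
      qed
      then have "{p \<in> structure_codes U. holds (submetric U (fst p)) (snd p) \<eta> s x \<tau>} =
          {p \<in> structure_codes U. 0 < q} \<inter> {p \<in> topspace ?T. snd p ?k \<subseteq> V}"
        unfolding T NRel using False by auto
      ultimately show ?thesis by (simp only: openin_Int[OF const])
    qed (simp add: NRel)
  qed
qed

text \<open>The difficulty is that the tuple must lie in the varying carrier. The open set
  \<open>W \<eta> xs\<close> asks only that the carrier come within \<open>\<eta>\<close> of each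
  point of \<open>xs\<close>, and that the tests hold for \<open>xs\<close> with margin
  \<open>2 * \<eta>\<close>. Moving the points into the carrier uses up \<open>\<eta>\<close> and
  leaves the margin \<open>\<eta>\<close>. Conversely, a tuple in the carrier with margin
  \<open>\<eta>\<close> witnesses membership for \<open>\<eta> / 2\<close>.\<close>

lemma openin_passes:
  assumes s: "s > 0"
  shows "openin (structure_topology U)
    {p \<in> structure_codes U. passes (submetric U (fst p)) (snd p) ts s}"
proof -
  interpret Metric_space "mspace U" "mdist U" by simp
  let ?T = "structure_topology U"
  have T: "topspace ?T = structure_codes U" by (rule topspace_structure_topology)
  define W where "W \<eta> xs = (\<Inter>x\<in>set xs. {p \<in> topspace ?T. fst p \<inter> mball x \<eta> \<noteq> {}}) \<inter>
      (\<Inter>\<tau>\<in>set ts. {p \<in> structure_codes U. holds (submetric U (fst p)) (snd p) (2 * \<eta>) s (pt xs) \<tau>}) \<inter>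
      structure_codes U" for \<eta> xs
  have oW: "openin ?T (W \<eta> xs)" if xs: "xs \<noteq> []" "set xs \<subseteq> mspace U" for \<eta> xs
  proof -
    have oB: "openin ?T {p \<in> topspace ?T. fst p \<inter> mball x \<eta> \<noteq> {}}" for x
      by (rule openin_preimage_Vietoris(2)[OF continuous_map_carrier]) (simp add: mtopology_of_def)
    have "pt xs a \<in> mspace U" for a
      using pt_in_set[OF xs(1)] xs(2) by blast
    then have oh: "openin ?T {p \<in> structure_codes U. holds (submetric U (fst p)) (snd p) (2 * \<eta>) s (pt xs) \<tau>}" for \<tau>
      by (rule openin_holds[OF _ s])
    have oT: "openin ?T (structure_codes U)" using openin_topspace[of ?T] unfolding T .
    let ?F = "(\<lambda>x. {p \<in> topspace ?T. fst p \<inter> mball x \<eta> \<noteq> {}}) ` set xs"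
    let ?H = "(\<lambda>\<tau>. {p \<in> structure_codes U. holds (submetric U (fst p)) (snd p) (2 * \<eta>) s (pt xs) \<tau>}) ` set ts"
    have "openin ?T A" if "A \<in> insert (structure_codes U) (?F \<union> ?H)" for A
      using that oB oh oT by (elim insertE UnE imageE) simp_all
    then have "openin ?T (\<Inter>(insert (structure_codes U) (?F \<union> ?H)))"
      by (intro openin_Inter) simp_all
    moreover have "\<Inter>(insert (structure_codes U) (?F \<union> ?H)) = W \<eta> xs"
      unfolding W_def Inter_insert Inter_Un_distrib by (rule Int_commute)
    ultimately show ?thesis by simp
  qed
  have "openin ?T (\<Union>\<eta>\<in>{0<..}. \<Union>xs\<in>{xs. xs \<noteq> [] \<and> set xs \<subseteq> mspace U}. W \<eta> xs)"
  proof (intro openin_Union)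
    fix A assume "A \<in> (\<lambda>\<eta>. \<Union>xs\<in>{xs. xs \<noteq> [] \<and> set xs \<subseteq> mspace U}. W \<eta> xs) ` {0<..}"
    then obtain \<eta> where A: "A = (\<Union>xs\<in>{xs. xs \<noteq> [] \<and> set xs \<subseteq> mspace U}. W \<eta> xs)" by (elim imageE)
    show "openin ?T A" unfolding A
    proof (intro openin_Union)
      fix B assume "B \<in> W \<eta> ` {xs. xs \<noteq> [] \<and> set xs \<subseteq> mspace U}"
      then show "openin ?T B" using oW by (elim imageE) simp
    qed
  qed
  moreover have "{p \<in> structure_codes U. passes (submetric U (fst p)) (snd p) ts s} =
     (\<Union>\<eta>\<in>{0<..}. \<Union>xs\<in>{xs. xs \<noteq> [] \<and> set xs \<subseteq> mspace U}. W \<eta> xs)" (is "?L = ?R")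
  proof (intro equalityI subsetI)
    fix p assume p: "p \<in> ?L"
    obtain M R where MR: "p = (M, R)" by (cases p)
    have pM: "(M, R) \<in> structure_codes U" and "passes (submetric U M) R ts s"
      using p unfolding MR by simp_all
    note code = structure_codesD[OF pM]
    obtain \<eta> xs where \<eta>: "\<eta> > 0" and xs: "xs \<noteq> []" "set xs \<subseteq> M"
      and h: "\<forall>\<tau>\<in>set ts. holds (submetric U M) R \<eta> s (pt xs) \<tau>"
      using \<open>passes (submetric U M) R ts s\<close> unfolding passes_def code(2) by blast
    have "M \<inter> mball x (\<eta> / 2) \<noteq> {}" if "x \<in> set xs" for x
    proof -
      have "x \<in> M \<inter> mball x (\<eta> / 2)"
        using that xs code(1) \<eta> by auto
      then show ?thesis by blast
    qed
    then have "p \<in> W (\<eta> / 2) xs"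
      unfolding W_def T MR by (intro IntI INT_I CollectI conjI) (simp_all add: pM h)
    moreover have "\<eta> / 2 \<in> {0<..}" "xs \<in> {xs. xs \<noteq> [] \<and> set xs \<subseteq> mspace U}"
      using \<eta> xs code(1) by auto
    ultimately show "p \<in> ?R" by (intro UN_I[of "\<eta> / 2"] UN_I[of xs])
  next
    fix p assume "p \<in> ?R"
    then obtain \<eta> xs where \<eta>: "\<eta> > 0" and xs: "xs \<noteq> []" "set xs \<subseteq> mspace U" and W: "p \<in> W \<eta> xs"
      by auto
    obtain M R where MR: "p = (M, R)" by (cases p)
    have p: "(M, R) \<in> structure_codes U" using W unfolding W_def MR by simp
    note code = structure_codesD[OF p]
    have meets: "M \<inter> mball x \<eta> \<noteq> {}" if "x \<in> set xs" for x
      using W that unfolding W_def MR by (elim IntE INT_E) auto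
    define f where "f x = (SOME y. y \<in> M \<inter> mball x \<eta>)" for x
    have "f x \<in> M \<inter> mball x \<eta>" if "x \<in> set xs" for x
      unfolding f_def some_in_eq by (rule meets[OF that])
    then have f: "f x \<in> M \<and> mdist U x (f x) < \<eta>" if "x \<in> set xs" for x
      using that by auto
    have "(M, R) \<in> (\<Inter>\<tau>\<in>set ts. {p \<in> structure_codes U.
        holds (submetric U (fst p)) (snd p) (2 * \<eta>) s (pt xs) \<tau>})"
      using W unfolding W_def MR by (elim IntE)
    then have hW: "holds (submetric U M) R (2 * \<eta>) s (pt xs) \<tau>" if "\<tau> \<in> set ts" for \<tau>
      using that by simp
    have hf: "holds (submetric U M) R \<eta> s (pt (map f xs)) \<tau>" if \<tau>: "\<tau> \<in> set ts" for \<tau>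
    proof (rule holds_perturb[OF _ s code(1) code(4), where x = "pt xs" and \<delta> = \<eta>])
      show "holds (submetric U M) R (\<eta> + \<eta>) s (pt xs) \<tau>"
        using hW[OF \<tau>] by (simp only: mult_2)
      show "pt xs a \<in> mspace U" for a
        using pt_in_set[OF xs(1), of a] xs(2) by blast
      show "pt (map f xs) a \<in> mspace U" "mdist U (pt xs a) (pt (map f xs) a) \<le> \<eta>" for a
        using f[OF pt_in_set[OF xs(1), of a]] code(1) by (auto simp: pt_map[OF xs(1)])
    qed
    have "map f xs \<noteq> []" "set (map f xs) \<subseteq> mspace (submetric U M)"
      unfolding code(2) using xs(1) f by auto
    then have "passes (submetric U M) R ts s"
      unfolding passes_def
      using \<eta> hf by (intro exI[of _ \<eta>] conjI exI[of _ "map f xs"]) simp_all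
    then show "p \<in> ?L" using p unfolding MR by simp
  qed
  ultimately show ?thesis by simp
qed

section \<open>From passed tests to approximate isomorphisms\<close>

lemma finite_net_list:
  assumes c: "compact_space (mtopology_of m)" and \<epsilon>: "\<epsilon> > 0" and ne: "mspace m \<noteq> {}"
  shows "\<exists>xs. xs \<noteq> [] \<and> set xs \<subseteq> mspace m \<and>
    (\<forall>u\<in>mspace m. \<exists>a<length xs. mdist m u (pt xs a) < \<epsilon>)"
proof -
  interpret Metric_space "mspace m" "mdist m" by simp
  have "mtotally_bounded (mspace m)"
    using c by (intro compactin_imp_mtotally_bounded) (simp add: compact_space_def mtopology_of_def)
  then obtain K where K: "finite K" "K \<subseteq> mspace m" "mspace m \<subseteq> (\<Union>x\<in>K. mball x \<epsilon>)"
    unfolding mtotally_bounded_def using \<epsilon> by meson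
  obtain xs where xs: "set xs = K" using finite_list[OF K(1)] by blast
  show ?thesis
  proof (intro exI[of _ xs] conjI ballI)
    show "xs \<noteq> []" using xs K(3) ne by auto
    show "set xs \<subseteq> mspace m" using xs K(2) by simp
    fix u assume "u \<in> mspace m"
    then obtain x where x: "x \<in> set xs" "u \<in> mball x \<epsilon>" using K(3) xs by blast
    then obtain a where a: "a < length xs" "xs ! a = x" by (auto simp: in_set_conv_nth)
    show "\<exists>a<length xs. mdist m u (pt xs a) < \<epsilon>"
      using a x(2) by (intro exI[of _ a]) (auto simp: pt_nth mdist_commute)
  qed
qed

text \<open>All tests that are true of a fine net \<open>x\<close> of \<open>m\<close>, taken from a
  finite stock, are satisfied by some tuple \<open>y\<close> in \<open>n\<close> at scale
  \<open>s\<close>. Then \<open>y\<close> is again a net, with distances comparable to those of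
  \<open>x\<close>. Each map sends a point to the nearby net point of its own space and then across
  by the index. One direction of transfer yields both maps because the stock contains lower bounds
  as well as upper ones.\<close>

lemma passes_imp_approx:
  fixes m :: "'a metric" and n :: "'b metric" and \<sigma> :: rat
  assumes m: "compact_metric_structure m R" and n: "compact_metric_structure n S"
    and \<sigma>: "\<sigma> \<ge> 1" and ne: "mspace m \<noteq> {}"
    and p: "\<And>ts. passes m R ts 2 \<Longrightarrow> passes n S ts (of_rat \<sigma>)"
    and e: "e > 0"
  shows "\<exists>f g. f \<in> mspace m \<rightarrow> mspace n \<and> g \<in> mspace n \<rightarrow> mspace m \<and>
      (\<forall>x\<in>mspace m. \<forall>z\<in>mspace n. mdist n (f x) z \<le> of_rat \<sigma> * mdist m x (g z) + e \<and>
          mdist m x (g z) \<le> of_rat \<sigma> * mdist n (f x) z + e) \<and>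
      (\<forall>k\<ge>1. real k \<le> 1/e \<longrightarrow>
         (\<forall>x\<in>R k. \<exists>w\<in>S k. \<forall>j<k. mdist n (f (x j)) (w j) \<le> e) \<and>
         (\<forall>w\<in>S k. \<exists>x\<in>R k. \<forall>j<k. mdist m (g (w j)) (x j) \<le> e))"
proof -
  define s where "s = real_of_rat \<sigma>"
  have s: "s \<ge> 1" using \<sigma> by (simp add: s_def)
  \<comment> \<open>The sum of the coefficients of \<open>\<epsilon>\<close> in the errors below:
    \<open>3 * s\<close> when bounding distances in \<open>n\<close>, and \<open>2 + s * s\<close>
    when bounding distances in \<open>m\<close>. The errors \<open>s * \<epsilon>\<close> and
    \<open>s * s * \<epsilon>\<close> for the relations are covered as well.\<close>
  define C where "C = 2 + 3 * s + s * s"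
  have C: "C > 0" using s by (simp add: C_def add_pos_nonneg)
  obtain q where q: "0 < real_of_rat q" "real_of_rat q < e / C"
    using of_rat_dense[of 0 "e / C"] e C by auto
  define \<epsilon> where "\<epsilon> = real_of_rat q"
  have \<epsilon>: "\<epsilon> > 0" and "C * \<epsilon> < e" using q C by (simp_all add: \<epsilon>_def field_simps)
  then have "2 * \<epsilon> + 3 * (s * \<epsilon>) + s * (s * \<epsilon>) < e" by (simp add: C_def algebra_simps)
  moreover have s\<epsilon>: "0 < s * \<epsilon>" "0 < s * (s * \<epsilon>)" using s \<epsilon> by simp_all
  ultimately have err: "3 * (s * \<epsilon>) \<le> e" "2 * \<epsilon> + s * (s * \<epsilon>) \<le> e" "s * \<epsilon> \<le> e" "s * (s * \<epsilon>) \<le> e"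
    using \<epsilon> by linarith+
  have q0: "q > 0" using q(1) by simp
  have "compact_space (mtopology_of m)" using m by (simp add: compact_metric_structure_def)
  from finite_net_list[OF this \<epsilon> ne] obtain xs where xs: "xs \<noteq> []" "set xs \<subseteq> mspace m"
    and net: "\<forall>u\<in>mspace m. \<exists>a<length xs. mdist m u (pt xs a) < \<epsilon>"
    by (elim exE conjE)
  define N where "N = length xs"
  define x where "x = pt xs"
  have xm: "x a \<in> mspace m" for a using pt_in_set[OF xs(1)] xs(2) unfolding x_def by blast
  define K where "K = nat \<lceil>1 / e\<rceil>"
  \<comment> \<open>The bounds record the distances of the net up to \<open>\<epsilon>\<close>. The bound \<open>\<sigma>\<^sup>2 q\<close> in \<open>NRel\<close> is large enough to
    survive the loss of a factor \<open>\<sigma>\<close> against the net of mesh \<open>\<sigma> \<epsilon>\<close> obtained in \<open>n\<close>.\<close>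
  define near where "near a b = (SOME q. mdist m (x a) (x b) < real_of_rat q \<and>
      real_of_rat q < mdist m (x a) (x b) + \<epsilon>)" for a b
  have near: "mdist m (x a) (x b) < of_rat (near a b)"
    "of_rat (near a b) < mdist m (x a) (x b) + \<epsilon>" for a b
    using someI_ex[OF of_rat_dense[of "mdist m (x a) (x b)" "mdist m (x a) (x b) + \<epsilon>"]] \<epsilon>
    unfolding near_def by simp_all
  define far where "far a b = (SOME q. mdist m (x a) (x b) - \<epsilon> < real_of_rat q \<and>
      real_of_rat q < mdist m (x a) (x b))" for a b
  have far: "mdist m (x a) (x b) - \<epsilon> < of_rat (far a b)"
    "of_rat (far a b) < mdist m (x a) (x b)" for a b
    using someI_ex[OF of_rat_dense[of "mdist m (x a) (x b) - \<epsilon>" "mdist m (x a) (x b)"]] \<epsilon>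
    unfolding far_def by simp_all
  \<comment> \<open>Only arities up to \<open>1 / e\<close> have to be matched, so finitely many
    index lists suffice.\<close>
  define I where "I = {t. set t \<subseteq> {..<N} \<and> length t \<le> K}"
  define T where "T = (\<lambda>(a, b). Near a b (near a b)) ` ({..<N} \<times> {..<N}) \<union>
      (\<lambda>(a, b). Far a b (far a b)) ` ({..<N} \<times> {..<N}) \<union> {Dense N q} \<union>
      (\<lambda>t. Rel t q) ` I \<union> (\<lambda>t. NRel t (\<sigma> * \<sigma> * q)) ` I"
  have "finite I" unfolding I_def by (rule finite_lists_length_le) simp
  then have "finite T" unfolding T_def by simp
  then have "finite {\<tau>\<in>T. holds m R 0 1 x \<tau>}" by simp
  \<comment> \<open>Only the true tests are listed, so a test that fails for \<open>y\<close> must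
    have failed for \<open>x\<close>; the argument for \<open>NRel\<close> rests on this.\<close>
  then obtain ts where ts: "set ts = {\<tau>\<in>T. holds m R 0 1 x \<tau>}" using finite_list by blast
  have "passes m R ts 2"
    using passes_slack[OF xs, of 1 ts R] ts unfolding x_def by simp
  then have "passes n S ts s" unfolding s_def by (rule p)
  then obtain \<eta> ys where \<eta>: "\<eta> > 0" and ys: "ys \<noteq> []" "set ys \<subseteq> mspace n"
    and "\<And>\<tau>. \<tau> \<in> set ts \<Longrightarrow> holds n S \<eta> s (pt ys) \<tau>"
    unfolding passes_def by blast
  then have h: "holds n S 0 s (pt ys) \<tau>" if "\<tau> \<in> T" "holds m R 0 1 x \<tau>" for \<tau>
    using that ts \<eta> s holds_antimono[of n S \<eta> s "pt ys" \<tau> 0] by simp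
  define y where "y = pt ys"
  have yn: "y a \<in> mspace n" for a using pt_in_set[OF ys(1)] ys(2) unfolding y_def by blast
  have d1: "mdist n (y a) (y b) < s * (mdist m (x a) (x b) + \<epsilon>)" if "a < N" "b < N" for a b
  proof -
    have "Near a b (near a b) \<in> T" using that unfolding T_def by auto
    then have "mdist n (y a) (y b) < s * of_rat (near a b)"
      using h[of "Near a b (near a b)"] near(1)[of a b] by (simp add: y_def)
    also have "\<dots> < s * (mdist m (x a) (x b) + \<epsilon>)" using near(2)[of a b] s by simp
    finally show ?thesis .
  qed
  have d2: "mdist m (x a) (x b) - \<epsilon> \<le> s * mdist n (y a) (y b)" if "a < N" "b < N" for a b
  proof (cases "0 < far a b")
    case True
    have "Far a b (far a b) \<in> T" using that unfolding T_def by auto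
    then have "of_rat (far a b) < s * mdist n (y a) (y b)"
      using h[of "Far a b (far a b)"] far(2)[of a b] True by (simp add: y_def)
    then show ?thesis using far(1)[of a b] by simp
  next
    \<comment> \<open>\<open>Far\<close> accepts positive bounds only. If the bound is not positive,
      the two net points are closer than \<open>\<epsilon>\<close> and the estimate is
      trivial.\<close>
    case False
    then have "real_of_rat (far a b) \<le> 0" by simp
    moreover have "0 \<le> s * mdist n (y a) (y b)" using s by simp
    ultimately show ?thesis using far(1)[of a b] by linarith
  qed
  have "Dense N q \<in> T" "holds m R 0 1 x (Dense N q)"
    using q0 net unfolding T_def by (auto simp: x_def N_def \<epsilon>_def)
  then have "holds n S 0 s y (Dense N q)" using h unfolding y_def by blast
  then have net': "\<exists>b<N. mdist n z (y b) < s * \<epsilon>" if "z \<in> mspace n" for z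
    using that by (simp add: \<epsilon>_def)
  define a where "a u = (SOME a. a < N \<and> mdist m u (x a) < \<epsilon>)" for u
  define b where "b z = (SOME b. b < N \<and> mdist n z (y b) < s * \<epsilon>)" for z
  have a: "a u < N" "mdist m u (x (a u)) < \<epsilon>" if "u \<in> mspace m" for u
    using someI_ex[OF bspec[OF net that, folded N_def x_def]] unfolding a_def by blast+
  have b: "b z < N" "mdist n z (y (b z)) < s * \<epsilon>" if "z \<in> mspace n" for z
    using someI_ex[OF net'[OF that]] unfolding b_def by blast+
  have RP: "u \<in> {..<k} \<rightarrow>\<^sub>E mspace m" if "u \<in> R k" "k \<ge> 1" for u k
    using m that closedin_subset[of "power_topology (mtopology_of m) k" "R k"]
    by (auto simp: compact_metric_structure_def)
  have SP: "w \<in> {..<k} \<rightarrow>\<^sub>E mspace n" if "w \<in> S k" "k \<ge> 1" for w k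
    using n that closedin_subset[of "power_topology (mtopology_of n) k" "S k"]
    by (auto simp: compact_metric_structure_def)
  have tI: "map c [0..<k] \<in> I" if "real k \<le> 1 / e" "\<And>j. j < k \<Longrightarrow> c j < N" for c k
  proof -
    have "k \<le> K" unfolding K_def using that(1) by linarith
    then show ?thesis using that(2) unfolding I_def by auto
  qed
  define f where "f u = y (a u)" for u
  define g where "g z = x (b z)" for z
  have fg: "mdist n (f u) z \<le> s * mdist m u (g z) + e" "mdist m u (g z) \<le> s * mdist n (f u) z + e"
    if u: "u \<in> mspace m" and z: "z \<in> mspace n" for u z
  proof -
    let ?X = "mdist m (x (a u)) (x (b z))" and ?Y = "mdist n (y (a u)) (y (b z))"
    have 1: "mdist n (f u) z \<le> ?Y + mdist n z (y (b z))"
      using mdist_triangle[OF yn[of "a u"] yn[of "b z"] z] by (simp add: f_def mdist_commute)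
    have "?X \<le> mdist m u (x (a u)) + mdist m u (g z)"
      using mdist_triangle[OF xm[of "a u"] u xm[of "b z"]] by (simp add: g_def mdist_commute)
    then have "s * (?X + \<epsilon>) \<le> s * (2 * \<epsilon> + mdist m u (g z))"
      using a(2)[OF u] s by (intro mult_left_mono) auto
    then show "mdist n (f u) z \<le> s * mdist m u (g z) + e"
      using 1 b[OF z] d1[OF a(1)[OF u] b(1)[OF z]] err(1) by (simp add: algebra_simps)
    have 2: "mdist m u (g z) \<le> mdist m u (x (a u)) + ?X"
      using mdist_triangle[OF u xm[of "a u"] xm[of "b z"]] by (simp add: g_def)
    have "?Y \<le> mdist n (f u) z + mdist n z (y (b z))"
      using mdist_triangle[OF yn[of "a u"] z yn[of "b z"]] by (simp add: f_def)
    then have "s * ?Y \<le> s * (mdist n (f u) z + s * \<epsilon>)"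
      using b(2)[OF z] s by (intro mult_left_mono) auto
    then show "mdist m u (g z) \<le> s * mdist n (f u) z + e"
      using 2 a[OF u] d2[OF a(1)[OF u] b(1)[OF z]] err(2) by (simp add: algebra_simps)
  qed
  have Rf: "\<exists>w\<in>S k. \<forall>j<k. mdist n (f (u j)) (w j) \<le> e"
    if k: "k \<ge> 1" "real k \<le> 1 / e" and u: "u \<in> R k" for k u
  proof -
    define t where "t = map (\<lambda>j. a (u j)) [0..<k]"
    have uj: "u j \<in> mspace m" if "j < k" for j using RP[OF u k(1)] that by (auto simp: PiE_iff)
    have t: "length t = k" "t \<noteq> []" "\<And>j. j < k \<Longrightarrow> t ! j = a (u j)"
      using k(1) unfolding t_def by auto
    have "Rel t q \<in> T" using tI[OF k(2), of "\<lambda>j. a (u j)"] a(1)[OF uj] unfolding T_def t_def by blast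
    moreover have "holds m R 0 1 x (Rel t q)"
      using t u q0 a(2)[OF uj] by (auto simp: \<epsilon>_def intro!: bexI[of _ u])
    ultimately have "holds n S 0 s y (Rel t q)" using h unfolding y_def by blast
    then obtain w where w: "w \<in> S k" "\<forall>j<k. mdist n (w j) (y (t ! j)) < s * \<epsilon>"
      using t(1) by (simp add: \<epsilon>_def) blast
    have "mdist n (f (u j)) (w j) \<le> e" if "j < k" for j
      using w(2) t(3)[OF that] err(3) that by (force simp: f_def mdist_commute[of n "w j"])
    then show ?thesis using w(1) by blast
  qed
  have Sg: "\<exists>u\<in>R k. \<forall>j<k. mdist m (g (w j)) (u j) \<le> e"
    if k: "k \<ge> 1" "real k \<le> 1 / e" and w: "w \<in> S k" for k w
  proof -
    define t where "t = map (\<lambda>j. b (w j)) [0..<k]"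
    have wj: "w j \<in> mspace n" if "j < k" for j using SP[OF w k(1)] that by (auto simp: PiE_iff)
    have t: "length t = k" "t \<noteq> []" "\<And>j. j < k \<Longrightarrow> t ! j = b (w j)"
      using k(1) unfolding t_def by auto
    have T: "NRel t (\<sigma> * \<sigma> * q) \<in> T"
      using tI[OF k(2), of "\<lambda>j. b (w j)"] b(1)[OF wj] unfolding T_def t_def by blast
    have \<sigma>q: "real_of_rat (\<sigma> * \<sigma> * q) = s * (s * \<epsilon>)" "0 < \<sigma> * \<sigma> * q"
      using \<sigma> q0 by (simp_all add: s_def \<epsilon>_def of_rat_mult)
    \<comment> \<open>The tuple \<open>w\<close> itself refutes the test in \<open>n\<close>, since
      it lies within \<open>s * \<epsilon>\<close> of the net tuple indexed by \<open>t\<close>. The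
      failure of the test in \<open>m\<close> then provides the required tuple of
      \<open>R k\<close>.\<close>
    have "\<not> holds n S 0 s y (NRel t (\<sigma> * \<sigma> * q))"
    proof
      assume "holds n S 0 s y (NRel t (\<sigma> * \<sigma> * q))"
      then have "\<forall>z\<in>S k. \<exists>j<k. s * (s * \<epsilon>) < s * (mdist n (z j) (y (t ! j)) - 0)"
        unfolding holds.simps t(1) \<sigma>q(1) by (elim conjE)
      then obtain j where j: "j < k" "s * (s * \<epsilon>) < s * mdist n (w j) (y (t ! j))"
        using w by auto
      then have "s * \<epsilon> < mdist n (w j) (y (b (w j)))" using s t(3) by simp
      then show False using b(2)[OF wj[OF j(1)]] by simp
    qed
    then have "\<not> holds m R 0 1 x (NRel t (\<sigma> * \<sigma> * q))" using h[OF T] unfolding y_def by blast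
    then have "\<exists>u\<in>R k. \<forall>j<k. mdist m (u j) (x (t ! j)) \<le> s * (s * \<epsilon>)"
      unfolding holds.simps t(1) \<sigma>q(1) using t(2) \<sigma>q(2) by (simp add: not_less imp_conv_disj)
    then obtain u where u: "u \<in> R k" "\<forall>j<k. mdist m (u j) (x (t ! j)) \<le> s * (s * \<epsilon>)"
      by (elim bexE)
    have "mdist m (g (w j)) (u j) \<le> e" if "j < k" for j
    proof -
      have "mdist m (u j) (x (b (w j))) \<le> s * (s * \<epsilon>)"
        using u(2)[rule_format, OF that] unfolding t(3)[OF that] .
      then show ?thesis using err(4) by (simp add: g_def mdist_commute)
    qed
    then show ?thesis using u(1) by blast
  qed
  have "f \<in> mspace m \<rightarrow> mspace n" "g \<in> mspace n \<rightarrow> mspace m"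
    using xm yn by (auto simp: f_def g_def)
  then show ?thesis
    unfolding s_def[symmetric]
    by (intro exI[of _ f] exI[of _ g] conjI ballI allI impI fg Rf Sg)
qed

section \<open>Codes of structures\<close>

lemma second_countable_euclidean:
  "second_countable (euclidean :: 'a::second_countable_topology topology)"
proof -
  obtain B :: "'a set set" where B: "countable B" "topological_basis B"
    using ex_countable_basis by blast
  show ?thesis
    unfolding second_countable_def
  proof (intro exI[of _ B] conjI ballI allI impI)
    show "openin euclidean V" if "V \<in> B" for V
      using topological_basis_open[OF B(2) that] by simp
    show "\<exists>V\<in>B. x \<in> V \<and> V \<subseteq> W" if "openin euclidean W \<and> x \<in> W" for W :: "'a set" and x
      using topological_basisE[OF B(2), of W x] that by (metis open_openin)
  qed (rule B(1))
qed

text \<open>Bits are real numbers so that implication between bits becomes \<open>\<le>\<close>,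
  visibly a closed condition on the coordinates.\<close>

definition bit_sequences :: "('i \<Rightarrow> real) set" where
  "bit_sequences = {f. range f \<subseteq> {0, 1}}"

definition shift_equivalence :: "(('i \<times> nat \<Rightarrow> real) \<times> ('i \<times> nat \<Rightarrow> real)) set" where
  "shift_equivalence = {(a, b). a \<in> bit_sequences \<and> b \<in> bit_sequences \<and>
     (\<exists>c. \<forall>i L. a (i, L) \<le> b (i, L + c) \<and> b (i, L) \<le> a (i, L + c))}"

lemma compact_bit_sequences: "compact (bit_sequences :: ('i \<Rightarrow> real) set)"
proof -
  have "compactin (product_topology (\<lambda>_::'i. euclidean :: real topology) UNIV) (PiE UNIV (\<lambda>_. {0, 1}))"
    unfolding compactin_PiE by simp
  moreover have "PiE UNIV (\<lambda>_::'i. {0, 1 :: real}) = bit_sequences"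
    unfolding bit_sequences_def PiE_UNIV_domain by auto
  ultimately show ?thesis by (simp add: euclidean_product_topology)
qed

text \<open>For a fixed shift \<open>c\<close> the relation is cut out of a compact square by closed
  conditions on pairs of coordinates, and the union over \<open>c\<close> is countable. Shifts add
  up under composition, which gives transitivity.\<close>

lemma K_sigma_shift_equivalence:
  "K_sigma_equivalence (top_of_set (bit_sequences :: ('i::countable \<times> nat \<Rightarrow> real) set)) shift_equivalence"
  unfolding K_sigma_equivalence_def Polish_topology_def
proof (intro conjI)
  let ?S = "bit_sequences :: ('i \<times> nat \<Rightarrow> real) set"
  have "closed ?S" using compact_bit_sequences by (rule compact_imp_closed)
  then show "completely_metrizable_space (top_of_set ?S)"
    by (intro completely_metrizable_space_closedin completely_metrizable_space_euclidean) simp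
  show "separable_space (top_of_set ?S)"
    by (intro second_countable_imp_separable_space second_countable_subtopology second_countable_euclidean)
  show "equiv (topspace (top_of_set ?S)) shift_equivalence"
  proof (rule equivI)
    show "shift_equivalence \<subseteq> topspace (top_of_set ?S) \<times> topspace (top_of_set ?S)"
      unfolding shift_equivalence_def by auto
    show "refl_on (topspace (top_of_set ?S)) shift_equivalence"
      unfolding shift_equivalence_def refl_on_def by (auto intro: exI[of _ 0])
    show "sym (shift_equivalence :: (('i \<times> nat \<Rightarrow> real) \<times> _) set)"
      unfolding shift_equivalence_def sym_def by blast
    show "trans (shift_equivalence :: (('i \<times> nat \<Rightarrow> real) \<times> _) set)"
    proof (rule transI)
      fix x y z :: "'i \<times> nat \<Rightarrow> real"
      assume "(x, y) \<in> shift_equivalence" "(y, z) \<in> shift_equivalence"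
      then obtain c d where xz: "x \<in> bit_sequences" "z \<in> bit_sequences"
        and c: "\<And>i L. x (i, L) \<le> y (i, L + c) \<and> y (i, L) \<le> x (i, L + c)"
        and d: "\<And>i L. y (i, L) \<le> z (i, L + d) \<and> z (i, L) \<le> y (i, L + d)"
        unfolding shift_equivalence_def by auto
      have "x (i, L) \<le> z (i, L + (c + d)) \<and> z (i, L) \<le> x (i, L + (c + d))" for i L
        using c[of i L] d[of i "L + c"] d[of i L] c[of i "L + d"] by (simp add: ac_simps)
      then show "(x, z) \<in> shift_equivalence"
        using xz unfolding shift_equivalence_def by blast
    qed
  qed
  define K where "K c = (?S \<times> ?S) \<inter> {p. \<forall>i L. fst p (i, L) \<le> snd p (i, L + c) \<and> snd p (i, L) \<le> fst p (i, L + c)}" for c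
  have c1: "continuous_on UNIV (\<lambda>p :: ('i \<times> nat \<Rightarrow> real) \<times> ('i \<times> nat \<Rightarrow> real). fst p j)" for j
    by (rule continuous_on_product_then_coordinatewise) (rule continuous_on_fst, rule continuous_on_id)
  have c2: "continuous_on UNIV (\<lambda>p :: ('i \<times> nat \<Rightarrow> real) \<times> ('i \<times> nat \<Rightarrow> real). snd p j)" for j
    by (rule continuous_on_product_then_coordinatewise) (rule continuous_on_snd, rule continuous_on_id)
  have "compact (K c)" for c
    unfolding K_def
    by (intro compact_Int_closed compact_Times compact_bit_sequences closed_Collect_all
        closed_Collect_conj closed_Collect_le c1 c2)
  then have "compactin (prod_topology (top_of_set ?S) (top_of_set ?S)) (K c)" for c
    by (simp add: compactin_subtopology K_def)
  moreover have "shift_equivalence = \<Union>(range K)"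
    unfolding shift_equivalence_def K_def by (auto; rule exI; assumption)
  ultimately show "(countable union_of compactin (prod_topology (top_of_set ?S) (top_of_set ?S)))
      (shift_equivalence :: (('i \<times> nat \<Rightarrow> real) \<times> _) set)"
    unfolding union_of_def by (intro exI[of _ "range K"]) auto
qed

lemma measurable_borel_of_top_of_set:
  assumes f: "f \<in> borel_measurable M" and S: "f \<in> space M \<rightarrow> S"
  shows "f \<in> measurable M (borel_of (top_of_set S))"
proof (rule measurable_sigma_sets[OF sets_borel_of])
  show "{V. openin (top_of_set S) V} \<subseteq> Pow (topspace (top_of_set S))"
    using openin_subset by blast
  show "f \<in> space M \<rightarrow> topspace (top_of_set S)" using S by simp
  fix V assume "V \<in> {V. openin (top_of_set S) V}"
  then obtain W where W: "open W" "V = W \<inter> S" by (auto simp: openin_open)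
  then have "f -` V \<inter> space M = f -` W \<inter> space M" using S by auto
  then show "f -` V \<inter> space M \<in> sets M"
    using measurable_sets[OF f borel_open[OF W(1)]] by simp
qed

section \<open>The reduction to the shift relation\<close>

definition pass_code :: "'a metric \<Rightarrow> 'a set \<times> (nat \<Rightarrow> (nat \<Rightarrow> 'a) set) \<Rightarrow> test list \<times> nat \<Rightarrow> real" where
  "pass_code U p = (\<lambda>(ts, L). of_bool (passes (submetric U (fst p)) (snd p) ts (2 ^ L)))"

lemma measurable_pass_code:
  "pass_code U \<in> measurable (borel_of (structure_topology U)) (borel_of (top_of_set bit_sequences))"
proof (rule measurable_borel_of_top_of_set)
  let ?T = "structure_topology U"
  show "pass_code U \<in> space (borel_of ?T) \<rightarrow> bit_sequences"
    unfolding pass_code_def bit_sequences_def by (auto simp: of_bool_def split: if_splits)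
  show "pass_code U \<in> borel_measurable (borel_of ?T)"
  proof (rule measurable_coordinatewise_then_product)
    fix i :: "test list \<times> nat"
    obtain ts L where i: "i = (ts, L)" by (cases i)
    define W where "W = {p \<in> structure_codes U. passes (submetric U (fst p)) (snd p) ts (2 ^ L)}"
    have "openin ?T W" unfolding W_def by (rule openin_passes) simp
    then have "W \<in> sets (borel_of ?T)" unfolding sets_borel_of by (intro sigma_sets.Basic) simp
    then have "(indicator W :: _ \<Rightarrow> real) \<in> borel_measurable (borel_of ?T)"
      by (rule borel_measurable_indicator)
    then show "(\<lambda>p. pass_code U p i) \<in> borel_measurable (borel_of ?T)"
      by (rule measurable_cong[THEN iffD1, rotated])
        (auto simp: i pass_code_def W_def topspace_structure_topology indicator_def)
  qed
qed

lemma bi_Lipschitz_isomorphic_sym: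
  assumes "bi_Lipschitz_isomorphism m R n S \<phi>"
  shows "bi_Lipschitz_isomorphism n S m R (inv_into (mspace m) \<phi>)"
proof -
  let ?i = "inv_into (mspace m) \<phi>"
  have bij: "bij_betw \<phi> (mspace m) (mspace n)" and L: "Lipschitz_continuous_map m n \<phi>"
    and Li: "Lipschitz_continuous_map n m ?i"
    and RS: "\<And>k x. k \<ge> 1 \<Longrightarrow> x \<in> {..<k} \<rightarrow>\<^sub>E mspace m \<Longrightarrow> x \<in> R k \<longleftrightarrow> restrict (\<phi> \<circ> x) {..<k} \<in> S k"
    using assms unfolding bi_Lipschitz_isomorphism_def by blast+
  have bij': "bij_betw ?i (mspace n) (mspace m)" by (rule bij_betw_inv_into[OF bij])
  have \<phi>i: "\<phi> (?i z) = z" if "z \<in> mspace n" for z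
    using bij that by (simp add: bij_betw_inv_into_right)
  have ii: "inv_into (mspace n) ?i x = \<phi> x" if "x \<in> mspace m" for x
    using bij that by (simp add: inv_into_inv_into_eq)
  have im: "?i z \<in> mspace m" if "z \<in> mspace n" for z
    using bij_betwE[OF bij'] that by blast
  have "Lipschitz_continuous_map m n (inv_into (mspace n) ?i)"
    using L by (rule Lipschitz_continuous_map_eq) (simp add: ii)
  moreover have "z \<in> S k \<longleftrightarrow> restrict (?i \<circ> z) {..<k} \<in> R k"
    if "k \<ge> 1" "z \<in> {..<k} \<rightarrow>\<^sub>E mspace n" for k z
  proof -
    have "restrict (?i \<circ> z) {..<k} \<in> {..<k} \<rightarrow>\<^sub>E mspace m" using that(2) im by (auto simp: PiE_iff)
    moreover have "restrict (\<phi> \<circ> restrict (?i \<circ> z) {..<k}) {..<k} = z"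
      using that(2) \<phi>i by (intro ext) (auto simp: PiE_iff extensional_def)
    ultimately show ?thesis using RS[OF that(1)] by metis
  qed
  ultimately show ?thesis
    unfolding bi_Lipschitz_isomorphism_def using bij' Li by blast
qed

text \<open>An isomorphism shifts the code by the logarithm of its distortion. Conversely, a bounded
  shift gives one distortion bound valid for all lists of tests, hence approximate isomorphisms of
  uniform distortion and arbitrarily small error, to which the limit argument applies.\<close>

lemma pass_code_iff:
  assumes p: "(M, R) \<in> structure_codes U" and q: "(N, S) \<in> structure_codes U"
  shows "((M, R), (N, S)) \<in> bi_Lipschitz_isomorphic U \<longleftrightarrow>
    (pass_code U (M, R), pass_code U (N, S)) \<in> shift_equivalence"
proof -
  let ?m = "submetric U M" and ?n = "submetric U N"
  note m = structure_codesD[OF p] and n = structure_codesD[OF q]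
  have bits: "pass_code U x \<in> bit_sequences" for x
    unfolding pass_code_def bit_sequences_def by (auto simp: of_bool_def split: if_splits)
  have le: "pass_code U x (ts, L) \<le> pass_code U y (us, K) \<longleftrightarrow>
      (passes (submetric U (fst x)) (snd x) ts (2 ^ L) \<longrightarrow> passes (submetric U (fst y)) (snd y) us (2 ^ K))"
    for x y ts us L K
    by (simp add: pass_code_def)
  have code: "(pass_code U (M, R), pass_code U (N, S)) \<in> shift_equivalence \<longleftrightarrow>
    (\<exists>c. \<forall>ts L. (passes ?m R ts (2 ^ L) \<longrightarrow> passes ?n S ts (2 ^ (L + c))) \<and>
       (passes ?n S ts (2 ^ L) \<longrightarrow> passes ?m R ts (2 ^ (L + c))))"
    unfolding shift_equivalence_def by (simp add: bits le)
  have iso: "((M, R), (N, S)) \<in> bi_Lipschitz_isomorphic U \<longleftrightarrow> (\<exists>\<phi>. bi_Lipschitz_isomorphism ?m R ?n S \<phi>)"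
    using p q unfolding bi_Lipschitz_isomorphic_def by simp
  show ?thesis unfolding iso code
  proof
    assume "\<exists>\<phi>. bi_Lipschitz_isomorphism ?m R ?n S \<phi>"
    then obtain \<phi> where \<phi>: "bi_Lipschitz_isomorphism ?m R ?n S \<phi>" by blast
    note \<psi> = bi_Lipschitz_isomorphic_sym[OF \<phi>]
    \<comment> \<open>All shifts \<open>d \<ge> c\<close> are treated at once, so that the constants
      of the two directions can be replaced by their maximum.\<close>
    have step: "\<exists>c. \<forall>d\<ge>c. \<forall>ts L. passes m' R' ts (2 ^ L) \<longrightarrow> passes n' S' ts (2 ^ (L + d))"
      if iso: "bi_Lipschitz_isomorphism m' R' n' S' \<theta>"
        and R': "\<And>k. k \<ge> 1 \<Longrightarrow> R' k \<subseteq> {..<k} \<rightarrow>\<^sub>E mspace m'"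
        and S': "\<And>k. k \<ge> 1 \<Longrightarrow> S' k \<subseteq> {..<k} \<rightarrow>\<^sub>E mspace n'" for m' n' :: "'a metric" and R' S' \<theta>
    proof -
      obtain c where c: "\<And>x y. x \<in> mspace m' \<Longrightarrow> y \<in> mspace m' \<Longrightarrow> mdist n' (\<theta> x) (\<theta> y) \<le> 2 ^ c * mdist m' x y"
        "\<And>x y. x \<in> mspace m' \<Longrightarrow> y \<in> mspace m' \<Longrightarrow> mdist m' x y \<le> 2 ^ c * mdist n' (\<theta> x) (\<theta> y)"
        using bi_Lipschitz_isomorphism_scale[OF iso] by metis
      have "passes n' S' ts (2 ^ (L + d))" if d: "d \<ge> c" and p: "passes m' R' ts (2 ^ L)" for ts L d
      proof -
        have le: "u \<le> 2 ^ d * v" if "u \<le> 2 ^ c * v" "v \<ge> 0" for u v :: real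
          using that order_trans[OF that(1) mult_right_mono[of "2 ^ c" "2 ^ d" v]] d by simp
        have "passes n' S' ts (2 ^ d * 2 ^ L)"
          by (rule passes_bi_Lipschitz[OF iso _ _ R' S' le[OF c(1)] le[OF c(2)] p]) simp_all
        then show ?thesis by (simp add: power_add mult.commute)
      qed
      then show ?thesis by blast
    qed
    have RS: "R k \<subseteq> {..<k} \<rightarrow>\<^sub>E mspace ?m" "S k \<subseteq> {..<k} \<rightarrow>\<^sub>E mspace ?n" if "k \<ge> 1" for k
      using m(4)[OF that] n(4)[OF that] unfolding m(2) n(2) by simp_all
    have "\<exists>c. \<forall>e\<ge>c. \<forall>ts L. passes ?m R ts (2 ^ L) \<longrightarrow> passes ?n S ts (2 ^ (L + e))"
      by (rule step[OF \<phi> RS])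
    then obtain c where c: "\<forall>e\<ge>c. \<forall>ts L. passes ?m R ts (2 ^ L) \<longrightarrow> passes ?n S ts (2 ^ (L + e))" ..
    have "\<exists>d. \<forall>e\<ge>d. \<forall>ts L. passes ?n S ts (2 ^ L) \<longrightarrow> passes ?m R ts (2 ^ (L + e))"
      by (rule step[OF \<psi> RS(2,1)])
    then obtain d where d: "\<forall>e\<ge>d. \<forall>ts L. passes ?n S ts (2 ^ L) \<longrightarrow> passes ?m R ts (2 ^ (L + e))" ..
    from c d show "\<exists>c. \<forall>ts L. (passes ?m R ts (2 ^ L) \<longrightarrow> passes ?n S ts (2 ^ (L + c))) \<and>
       (passes ?n S ts (2 ^ L) \<longrightarrow> passes ?m R ts (2 ^ (L + c)))"
      by (intro exI[of _ "max c d"]) simp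
  next
    assume "\<exists>c. \<forall>ts L. (passes ?m R ts (2 ^ L) \<longrightarrow> passes ?n S ts (2 ^ (L + c))) \<and>
       (passes ?n S ts (2 ^ L) \<longrightarrow> passes ?m R ts (2 ^ (L + c)))"
    \<comment> \<open>\<open>L = 1\<close> is the scale 2 at which the true tests of a net are
      passed with a positive margin; after the shift the distortion is
      \<open>2 ^ (1 + c)\<close>.\<close>
    then obtain c where c: "\<And>ts. passes ?m R ts (2 ^ 1) \<Longrightarrow> passes ?n S ts (2 ^ (1 + c))"
      "\<And>ts. passes ?n S ts (2 ^ 1) \<Longrightarrow> passes ?m R ts (2 ^ (1 + c))" by blast
    show "\<exists>\<phi>. bi_Lipschitz_isomorphism ?m R ?n S \<phi>"
    proof (rule bi_Lipschitz_isomorphism_limit[OF m(3) n(3), where s = "of_rat (2 ^ (1 + c))"])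
      fix e :: real assume e: "e > 0"
      show "\<exists>f g. f \<in> mspace ?m \<rightarrow> mspace ?n \<and> g \<in> mspace ?n \<rightarrow> mspace ?m \<and>
        (\<forall>x\<in>mspace ?m. \<forall>z\<in>mspace ?n. mdist ?n (f x) z \<le> of_rat (2 ^ (1 + c)) * mdist ?m x (g z) + e \<and>
          mdist ?m x (g z) \<le> of_rat (2 ^ (1 + c)) * mdist ?n (f x) z + e) \<and>
        (\<forall>k\<ge>1. real k \<le> 1/e \<longrightarrow>
         (\<forall>x\<in>R k. \<exists>w\<in>S k. \<forall>j<k. mdist ?n (f (x j)) (w j) \<le> e) \<and>
         (\<forall>w\<in>S k. \<exists>x\<in>R k. \<forall>j<k. mdist ?m (g (w j)) (x j) \<le> e))"
      proof (cases "M = {}")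
        case False
        show ?thesis
        proof (rule passes_imp_approx[OF m(3) n(3) _ _ _ e])
          show "mspace ?m \<noteq> {}" unfolding m(2) by (rule False)
          show "passes ?n S ts (real_of_rat (2 ^ (1 + c)))" if "passes ?m R ts 2" for ts
            using c(1)[of ts] that by (simp add: of_rat_power of_rat_mult)
        qed (rule one_le_power, simp)
      next
        case True
        \<comment> \<open>An empty carrier has no net. Here the empty list of tests decides: it is
          passed exactly by structures with a nonempty carrier.\<close>
        have "N = {}"
        proof (rule ccontr)
          assume "N \<noteq> {}"
          then obtain z where "z \<in> N" by blast
          then have "passes ?n S [] (2 ^ 1)"
            unfolding passes_def n(2) by (intro exI[of _ 1] conjI exI[of _ "[z]"]) simp_all
          then have "passes ?m R [] (2 ^ (1 + c))" by (rule c(2))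
          then show False unfolding passes_def m(2) True by auto
        qed
        have "({..<k} \<rightarrow>\<^sub>E {}) = ({} :: (nat \<Rightarrow> 'a) set)" if "k \<ge> 1" for k
          using that by (auto simp: PiE_eq_empty_iff intro!: exI[of _ 0])
        then have "R k = {}" "S k = {}" if "k \<ge> 1" for k
          using m(4)[OF that] n(4)[OF that] that unfolding True \<open>N = {}\<close> by simp_all
        then show ?thesis unfolding m(2) n(2) True \<open>N = {}\<close> by simp
      qed
    qed simp
  qed
qed

section \<open>Reducing \<open>K\<^sub>\<sigma>\<close> equivalence relations to comparability of sequences\<close>

text \<open>The composition is the projection of those pairs in \<open>A \<times> B\<close> whose
  middle coordinates agree. In a Hausdorff space this agreement is a closed condition, so the
  projected set is compact.\<close>

lemma compactin_relcomp:
  assumes X: "Hausdorff_space X"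
    and A: "compactin (prod_topology X X) A" and B: "compactin (prod_topology X X) B"
  shows "compactin (prod_topology X X) (A O B)"
proof -
  let ?P = "prod_topology (prod_topology X X) (prod_topology X X)"
  define Z where "Z = {p \<in> topspace ?P. snd (fst p) = fst (snd p)}"
  have "continuous_map ?P X (snd \<circ> fst)" "continuous_map ?P X (fst \<circ> snd)"
    "continuous_map ?P X (fst \<circ> fst)" "continuous_map ?P X (snd \<circ> snd)"
    by (rule continuous_map_compose[OF continuous_map_fst continuous_map_snd]
        continuous_map_compose[OF continuous_map_snd continuous_map_fst]
        continuous_map_compose[OF continuous_map_fst continuous_map_fst]
        continuous_map_compose[OF continuous_map_snd continuous_map_snd])+
  then have c: "continuous_map ?P X (\<lambda>p. snd (fst p))" "continuous_map ?P X (\<lambda>p. fst (snd p))"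
    "continuous_map ?P X (\<lambda>p. fst (fst p))" "continuous_map ?P X (\<lambda>p. snd (snd p))"
    by (simp_all add: comp_def)
  have "closedin ?P Z"
    unfolding Z_def by (rule closedin_continuous_maps_eq[OF X c(1,2)])
  moreover have "compactin ?P (A \<times> B)" using A B by (simp add: compactin_Times)
  ultimately have "compactin ?P (Z \<inter> (A \<times> B))" by (rule closed_Int_compactin)
  moreover have "continuous_map ?P (prod_topology X X) (\<lambda>p. (fst (fst p), snd (snd p)))"
    unfolding continuous_map_pairwise comp_def using c(3,4) by simp
  ultimately have "compactin (prod_topology X X) ((\<lambda>p. (fst (fst p), snd (snd p))) ` (Z \<inter> (A \<times> B)))"
    by (rule image_compactin)
  moreover have "(\<lambda>p. (fst (fst p), snd (snd p))) ` (Z \<inter> (A \<times> B)) = A O B"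
  proof (intro equalityI subsetI)
    fix q assume "q \<in> A O B"
    then obtain x y z where q: "q = (x, z)" "(x, y) \<in> A" "(y, z) \<in> B" by blast
    then have "((x, y), (y, z)) \<in> Z \<inter> (A \<times> B)"
      using compactin_subset_topspace[OF A] compactin_subset_topspace[OF B] unfolding Z_def by auto
    then show "q \<in> (\<lambda>p. (fst (fst p), snd (snd p))) ` (Z \<inter> (A \<times> B))"
      by (rule rev_image_eqI) (simp add: q(1))
  qed (auto simp: Z_def)
  ultimately show ?thesis by simp
qed

lemma compactin_converse:
  assumes "compactin (prod_topology X X) A"
  shows "compactin (prod_topology X X) (A\<inverse>)"
proof -
  have "continuous_map (prod_topology X X) (prod_topology X X) (\<lambda>p. (snd p, fst p))"
    unfolding continuous_map_pairwise comp_def by (simp add: continuous_map_fst continuous_map_snd)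
  then have "compactin (prod_topology X X) ((\<lambda>p. (snd p, fst p)) ` A)"
    by (rule image_compactin[OF assms])
  moreover have "(\<lambda>p. (snd p, fst p)) ` A = A\<inverse>" by force
  ultimately show ?thesis by simp
qed

text \<open>Each level adds to its predecessor the compositions of that predecessor with itself, the
  next compact piece, and the converse of this piece. Compactness survives these operations, and the
  levels stay inside \<open>E\<close> because \<open>E\<close> is symmetric and transitive.\<close>

lemma K_sigma_levels:
  assumes X: "Hausdorff_space X" and E: "equiv (topspace X) E"
    and K: "(countable union_of compactin (prod_topology X X)) E"
  shows "\<exists>D :: nat \<Rightarrow> ('a \<times> 'a) set. (\<forall>n. compactin (prod_topology X X) (D n)) \<and> (\<Union>n. D n) = E \<and>
    mono D \<and> (\<forall>n. (D n)\<inverse> = D n) \<and> (\<forall>n. D n O D n \<subseteq> D (Suc n))"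
proof -
  obtain \<K> where \<K>: "countable \<K>" "\<K> \<subseteq> Collect (compactin (prod_topology X X))" "\<Union>\<K> = E"
    using K unfolding union_of_def by blast
  \<comment> \<open>The empty set is added so that the family to be enumerated is nonempty even when
    \<open>E\<close> is empty.\<close>
  define k where "k = from_nat_into (insert {} \<K>)"
  have rk: "range k = insert {} \<K>" unfolding k_def using \<K>(1) by simp
  have kc: "compactin (prod_topology X X) (k n)" for n
  proof -
    have "k n \<in> insert {} \<K>" using rk by blast
    then show ?thesis using \<K>(2) by auto
  qed
  have kE: "(\<Union>n. k n) = E" using rk \<K>(3) by auto
  define D where "D = rec_nat (k 0 \<union> (k 0)\<inverse>) (\<lambda>n S. S \<union> S O S \<union> k (Suc n) \<union> (k (Suc n))\<inverse>)"
  have D0: "D 0 = k 0 \<union> (k 0)\<inverse>"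
    and DS: "D (Suc n) = D n \<union> D n O D n \<union> k (Suc n) \<union> (k (Suc n))\<inverse>" for n
    unfolding D_def by simp_all
  have Dc: "compactin (prod_topology X X) (D n)" for n
    by (induction n) (simp_all add: D0 DS compactin_Un compactin_converse compactin_relcomp[OF X] kc)
  have Dsym: "(D n)\<inverse> = D n" for n
    by (induction n) (auto simp: D0 DS converse_Un converse_relcomp)
  have kD: "k n \<subseteq> D n" for n
    by (cases n) (auto simp: D0 DS)
  have symE: "sym E" and transE: "trans E" using E by (auto simp: equiv_def)
  have kE': "k n \<subseteq> E" for n using kE by blast
  then have kE'': "(k n)\<inverse> \<subseteq> E" for n using symE unfolding sym_def by blast
  have DE: "D n \<subseteq> E" for n
  proof (induction n)
    case 0
    then show ?case using kE' kE'' by (simp add: D0)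
  next
    case (Suc n)
    have "D n O D n \<subseteq> E" using relcomp_mono[OF Suc Suc] trans_O_subset[OF transE] by blast
    then show ?case using kE' kE'' Suc by (simp add: DS)
  qed
  have "(\<Union>n. D n) = E" using DE kD kE by blast
  moreover have "mono D" by (rule mono_iff_le_Suc[THEN iffD2]) (simp add: DS le_supI1)
  moreover have "D n O D n \<subseteq> D (Suc n)" for n by (auto simp: DS)
  ultimately show ?thesis using Dc Dsym by blast
qed

text \<open>Closed balls of rational radius around a countable dense set. The members are closed so
  that intersecting with them preserves compactness of the levels.\<close>

lemma Polish_closed_network:
  assumes "Polish_topology X"
  shows "\<exists>C :: nat \<Rightarrow> 'a set. (\<forall>i. closedin X (C i)) \<and>
    (\<forall>W x. openin X W \<longrightarrow> x \<in> W \<longrightarrow> (\<exists>i. x \<in> C i \<and> C i \<subseteq> W))"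
proof -
  obtain M d where Md: "Metric_space M d" and X: "X = Metric_space.mtopology M d"
    using assms by (auto simp: Polish_topology_def completely_metrizable_space_def)
  interpret Metric_space M d by (rule Md)
  obtain Q where Q: "countable Q" "Q \<subseteq> M" "mtopology closure_of Q = M"
    using assms unfolding Polish_topology_def separable_space_def X by auto
  define \<C> where "\<C> = insert {} ((\<lambda>(q, r). mcball q (real_of_rat r)) ` (Q \<times> UNIV))"
  have "countable \<C>" unfolding \<C>_def using Q(1) by auto
  then have r: "range (from_nat_into \<C>) = \<C>" unfolding \<C>_def by (intro range_from_nat_into) auto
  show ?thesis
  proof (intro exI[of _ "from_nat_into \<C>"] conjI allI impI)
    fix i
    have "from_nat_into \<C> i \<in> \<C>" using r by blast
    then show "closedin X (from_nat_into \<C> i)" unfolding X \<C>_def by auto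
  next
    fix W x assume "openin X W" and x: "x \<in> W"
    then have W: "W \<subseteq> M" "\<exists>r>0. mball x r \<subseteq> W" unfolding X openin_mtopology by auto
    then obtain r where r0: "r > 0" "mball x r \<subseteq> W" by blast
    have xM: "x \<in> M" using W(1) x by blast
    then have "x \<in> mtopology closure_of Q" using Q(3) by simp
    then obtain q where q: "q \<in> Q" "q \<in> mball x (r / 3)"
      using r0(1) unfolding metric_closure_of by (auto dest: spec[of _ "r / 3"])
    then have qM: "q \<in> M" and qx: "d x q < r / 3" by simp_all
    \<comment> \<open>The radius exceeds \<open>r / 3\<close>, so the ball around \<open>q\<close>
      contains \<open>x\<close>; it is below \<open>r / 2\<close>, so the ball stays within
      \<open>r / 3 + r / 2 < r\<close> of \<open>x\<close>.\<close>
    obtain t where t: "r / 3 < real_of_rat t" "real_of_rat t < r / 2"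
      using of_rat_dense[of "r / 3" "r / 2"] r0(1) by auto
    have "mcball q (real_of_rat t) \<in> \<C>" unfolding \<C>_def using q(1) by auto
    then obtain i where i: "from_nat_into \<C> i = mcball q (real_of_rat t)" using r by (metis rangeE)
    have "x \<in> mcball q (real_of_rat t)" using qM xM qx t(1) by (simp add: commute)
    moreover have "mcball q (real_of_rat t) \<subseteq> mball x r"
    proof
      fix y assume "y \<in> mcball q (real_of_rat t)"
      then have y: "y \<in> M" "d q y \<le> real_of_rat t" by auto
      have "d x y \<le> d x q + d q y" by (rule triangle[OF xM qM y(1)])
      then show "y \<in> mball x r" using y qx t xM by simp
    qed
    ultimately show "\<exists>i. x \<in> from_nat_into \<C> i \<and> from_nat_into \<C> i \<subseteq> W"
      using r0(2) i by (intro exI[of _ i]) auto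
  qed
qed

text \<open>For nonnegative sequences this says that the zeros coincide and that elsewhere the
  logarithms differ by a bounded amount: the relation of bounded difference, with infinite values
  allowed.\<close>

definition comparable :: "(nat \<Rightarrow> real) \<Rightarrow> (nat \<Rightarrow> real) \<Rightarrow> bool" where
  "comparable f g \<longleftrightarrow> (\<exists>K. \<forall>i. f i \<le> K * g i \<and> g i \<le> K * f i)"

text \<open>The value 0 stands for 2 to the power minus infinity. It occurs for a point that is
  related to no point of the closed set in question.\<close>

definition scale :: "(nat \<Rightarrow> bool) \<Rightarrow> real" where
  "scale P = (if \<exists>n. P n then (1/2) ^ (LEAST n. P n) else 0)"

lemma scale_bounds: "0 \<le> scale P" "scale P \<le> 1"
  unfolding scale_def by (auto simp: power_le_one)

lemma scale_ge: "P n \<Longrightarrow> (1/2) ^ n \<le> scale P"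
  unfolding scale_def by (auto intro: power_decreasing Least_le)

lemma scale_le:
  assumes "\<And>n. P n \<Longrightarrow> Q (n + c)"
  shows "scale P \<le> 2 ^ c * scale Q"
proof (cases "\<exists>n. P n")
  case True
  define n where "n = (LEAST n. P n)"
  have "P n" unfolding n_def using True by (rule LeastI_ex)
  then have "(1/2) ^ (n + c) \<le> scale Q" using scale_ge[of Q, OF assms] by blast
  then have "2 ^ c * (1/2) ^ (n + c) \<le> 2 ^ c * scale Q" by simp
  moreover have "2 ^ c * (1/2) ^ (n + c) = ((1/2) ^ n :: real)"
    by (simp add: power_add power_one_over)
  ultimately show ?thesis using True unfolding scale_def[of P] n_def by simp
next
  case False
  have "scale P = 0" unfolding scale_def by (rule if_not_P[OF False])
  then show ?thesis using scale_bounds(1)[of Q] by simp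
qed

lemma scale_leD:
  assumes le: "scale P \<le> 2 ^ c * scale Q" and P: "P n" and Q: "\<And>m k. Q m \<Longrightarrow> m \<le> k \<Longrightarrow> Q k"
  shows "Q (n + c)"
proof -
  have 1: "(1/2) ^ n \<le> 2 ^ c * scale Q" using scale_ge[of P, OF P] le by linarith
  have "\<exists>m. Q m"
  proof (rule ccontr)
    assume "\<nexists>m. Q m"
    then have "scale Q = 0" unfolding scale_def by (rule if_not_P)
    have "(1/2) ^ n \<le> (0 :: real)" using 1 unfolding \<open>scale Q = 0\<close> mult_zero_right .
    moreover have "0 < (1/2 :: real) ^ n" by (rule zero_less_power) simp
    ultimately show False by linarith
  qed
  define l where "l = (LEAST m. Q m)"
  have l: "Q l" unfolding l_def using \<open>\<exists>m. Q m\<close> by (rule LeastI_ex)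
  have "(1/2) ^ n \<le> 2 ^ c * (1/2 :: real) ^ l"
    using 1 \<open>\<exists>m. Q m\<close> unfolding scale_def l_def by simp
  then have "(2 :: real) ^ l \<le> 2 ^ (n + c)" by (simp add: power_add field_simps)
  then have "l \<le> n + c" by simp
  then show ?thesis using Q l by blast
qed

lemma measurable_scale:
  assumes "\<And>n. Measurable.pred M (\<lambda>x. P x n)"
  shows "(\<lambda>x. scale (P x)) \<in> borel_measurable M"
proof -
  note [measurable] = assms
  have [measurable]: "(\<lambda>x. LEAST n. P x n) \<in> measurable M (count_space UNIV)"
    by (rule measurable_Least) (rule assms)
  have "(\<lambda>x. (1/2 :: real) ^ (LEAST n. P x n)) \<in> borel_measurable M"
    by (rule measurable_compose[where N = "count_space UNIV"]) simp_all
  then show ?thesis unfolding scale_def by measurable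
qed

text \<open>Moving within one level changes each least index by a bounded amount, by the composition
  rule of the levels. If the points are comparable but \<open>x\<close> is missing from the section
  of \<open>D (n + c)\<close> at \<open>y\<close>, a closed set of the network around
  \<open>x\<close> avoids this section: the index of \<open>x\<close> is at most \<open>n\<close>
  for it, whereas that of \<open>y\<close> exceeds \<open>n + c\<close>.\<close>

lemma K_sigma_comparable_reduction:
  fixes X :: "'a topology"
  assumes E: "K_sigma_equivalence X E"
  shows "\<exists>F :: 'a \<Rightarrow> nat \<Rightarrow> real. F \<in> borel_measurable (borel_of X) \<and> (\<forall>x i. F x i \<in> {0..1}) \<and>
    (\<forall>x\<in>topspace X. \<forall>y\<in>topspace X. (x, y) \<in> E \<longleftrightarrow> comparable (F x) (F y))"
proof -
  have P: "Polish_topology X" and eq: "equiv (topspace X) E"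
    and K: "(countable union_of compactin (prod_topology X X)) E"
    using E unfolding K_sigma_equivalence_def by blast+
  have Haus: "Hausdorff_space X"
    using P unfolding Polish_topology_def
    by (intro metrizable_imp_Hausdorff_space completely_metrizable_imp_metrizable_space) simp
  obtain D :: "nat \<Rightarrow> ('a \<times> 'a) set" where Dc: "\<forall>n. compactin (prod_topology X X) (D n)"
    and DE: "(\<Union>n. D n) = E" and mono: "mono D" and Dsym: "\<forall>n. (D n)\<inverse> = D n"
    and Dtrans: "\<forall>n. D n O D n \<subseteq> D (Suc n)"
    using K_sigma_levels[OF Haus eq K] by (elim exE conjE)
  obtain C :: "nat \<Rightarrow> 'a set" where Cc: "\<forall>i. closedin X (C i)"
    and net: "\<forall>W x. openin X W \<longrightarrow> x \<in> W \<longrightarrow> (\<exists>i. x \<in> C i \<and> C i \<subseteq> W)"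
    using Polish_closed_network[OF P] by (elim exE conjE)
  define H where "H x i n \<longleftrightarrow> (\<exists>v\<in>C i. (x, v) \<in> D n)" for x i n
  define F where "F x i = scale (H x i)" for x i
  have Dmono: "D m \<subseteq> D n" if "m \<le> n" for m n using mono that by (rule monoD)
  have Hmono: "H x i n" if "H x i m" "m \<le> n" for x i m n
    using that Dmono[of m n] unfolding H_def by blast
  have "Measurable.pred (borel_of X) (\<lambda>x. H x i n)" for i n
  proof -
    \<comment> \<open>The points at index at most \<open>n\<close> from \<open>C i\<close> form the
      projection of a compact set, which is compact and therefore closed.\<close>
    let ?S = "fst ` ((topspace X \<times> C i) \<inter> D n)"
    have "closedin (prod_topology X X) (topspace X \<times> C i)"
      using Cc by (simp add: closedin_prod_Times_iff)
    then have "compactin (prod_topology X X) ((topspace X \<times> C i) \<inter> D n)"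
      using Dc by (intro closed_Int_compactin) simp_all
    then have "compactin X ?S" by (rule image_compactin) (rule continuous_map_fst)
    then have "closedin X ?S" by (rule compactin_imp_closedin[OF Haus])
    then have "openin X (topspace X - ?S)" by (simp add: closedin_def)
    then have "topspace X - ?S \<in> sets (borel_of X)"
      unfolding sets_borel_of by (intro sigma_sets.Basic) simp
    then have "space (borel_of X) - (topspace X - ?S) \<in> sets (borel_of X)" by (rule sets.compl_sets)
    moreover have "space (borel_of X) - (topspace X - ?S) = {x \<in> space (borel_of X). H x i n}"
      unfolding H_def by force
    ultimately show ?thesis by (simp add: pred_def)
  qed
  then have "F \<in> borel_measurable (borel_of X)"
    unfolding F_def by (intro measurable_coordinatewise_then_product measurable_scale)
  moreover have "F x i \<in> {0..1}" for x i unfolding F_def by (simp add: scale_bounds)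
  moreover have "(x, y) \<in> E \<longleftrightarrow> comparable (F x) (F y)" if x: "x \<in> topspace X" and y: "y \<in> topspace X" for x y
  proof
    assume "(x, y) \<in> E"
    then obtain c where "(x, y) \<in> D c" using DE by blast
    then have xy: "(y, x) \<in> D (max n c)" "(x, y) \<in> D (max n c)" for n
      using Dsym Dmono[of c "max n c"] by auto
    have step: "H v i (n + Suc c)" if uv: "H u i n" "\<And>n. (v, u) \<in> D (max n c)" for u v i n
    proof -
      obtain w where w: "w \<in> C i" "(u, w) \<in> D n" using uv(1) unfolding H_def by blast
      have "(v, w) \<in> D (max n c) O D (max n c)"
        using uv(2) w(2) Dmono[of n "max n c"] by auto
      \<comment> \<open>Both steps are lifted to the common level \<open>max n c\<close>, so that
        composing them raises the index by one only; the result is at most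
        \<open>n + Suc c\<close>.\<close>
      then have "(v, w) \<in> D (Suc (max n c))" using Dtrans by blast
      then have "H v i (Suc (max n c))" using w(1) unfolding H_def by blast
      then show ?thesis by (rule Hmono) simp
    qed
    have "F x i \<le> 2 ^ Suc c * F y i" "F y i \<le> 2 ^ Suc c * F x i" for i
      unfolding F_def using step xy by (intro scale_le; simp)+
    then show "comparable (F x) (F y)" unfolding comparable_def by blast
  next
    assume "comparable (F x) (F y)"
    then obtain K where K: "\<And>i. F x i \<le> K * F y i" unfolding comparable_def by blast
    obtain c where c: "K < 2 ^ c" using real_arch_pow[of 2 K] by auto
    have "F x i \<le> 2 ^ c * F y i" for i
    proof -
      have "K * F y i \<le> 2 ^ c * F y i"
        using c by (intro mult_right_mono) (simp_all add: F_def scale_bounds)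
      then show ?thesis using K[of i] by linarith
    qed
    then have Hxy: "H y i (n + c)" if "H x i n" for i n
      using scale_leD[of "H x i" c "H y i" n] that Hmono unfolding F_def by blast
    have "(x, x) \<in> E" using eq x unfolding equiv_def refl_on_def by blast
    \<comment> \<open>A compact level need not contain the whole diagonal, so \<open>n\<close>
      depends on \<open>x\<close>.\<close>
    then obtain n where n: "(x, x) \<in> D n" using DE by blast
    define S where "S = {v \<in> topspace X. (y, v) \<in> D (n + c)}"
    have "x \<in> S"
    proof (rule ccontr)
      assume "x \<notin> S"
      have "continuous_map X (prod_topology X X) (\<lambda>v. (y, v))"
        unfolding continuous_map_pairwise comp_def using y by simp
      moreover have "closedin (prod_topology X X) (D (n + c))"
        using Dc Haus by (intro compactin_imp_closedin) (simp_all add: Hausdorff_space_prod_topology)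
      ultimately have "closedin X S" unfolding S_def by (rule closedin_continuous_map_preimage)
      then have "openin X (topspace X - S)" by (simp add: closedin_def)
      moreover have "x \<in> topspace X - S" using x \<open>x \<notin> S\<close> by simp
      ultimately obtain i where i: "x \<in> C i" "C i \<subseteq> topspace X - S" using net by blast
      have "H x i n" using i(1) n unfolding H_def by blast
      then have "H y i (n + c)" by (rule Hxy)
      then obtain v where v: "v \<in> C i" "(y, v) \<in> D (n + c)" unfolding H_def by blast
      then show False using i(2) unfolding S_def by blast
    qed
    then have "(y, x) \<in> E" using DE unfolding S_def by blast
    then show "(x, y) \<in> E" using eq unfolding equiv_def by (blast dest: symD)
  qed
  ultimately show ?thesis by (intro exI[of _ F]) simp
qed

section \<open>Structures on the line\<close>

text \<open>The parametrizations need not be injective, since a coded pair of points may collapse.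
  The two estimates force \<open>x\<close> and \<open>y\<close> to identify the same indices, so
  matching equal indices is a well-defined bijection.\<close>

lemma bi_Lipschitz_isomorphism_indexed:
  fixes x :: "'i \<Rightarrow> 'a" and y :: "'i \<Rightarrow> 'b"
  assumes m: "mspace m = range x" and n: "mspace n = range y"
    and up: "\<And>a b. mdist n (y a) (y b) \<le> K * mdist m (x a) (x b)"
    and lo: "\<And>a b. mdist m (x a) (x b) \<le> K * mdist n (y a) (y b)"
    and RS: "\<And>k t. k \<ge> 1 \<Longrightarrow> restrict (x \<circ> t) {..<k} \<in> R k \<longleftrightarrow> restrict (y \<circ> t) {..<k} \<in> S k"
  shows "\<exists>\<phi>. bi_Lipschitz_isomorphism m R n S \<phi>"
proof -
  have xm: "x a \<in> mspace m" and yn: "y a \<in> mspace n" for a using m n by auto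
  have eq1: "y a = y b" if "x a = x b" for a b
  proof -
    have "mdist n (y a) (y b) \<le> 0" using up[of a b] mdist_zero[OF xm xm, of b b] that by simp
    then have "mdist n (y a) (y b) = 0" by (intro order.antisym) simp_all
    then show ?thesis using yn by simp
  qed
  have eq2: "x a = x b" if "y a = y b" for a b
  proof -
    have "mdist m (x a) (x b) \<le> 0" using lo[of a b] mdist_zero[OF yn yn, of b b] that by simp
    then have "mdist m (x a) (x b) = 0" by (intro order.antisym) simp_all
    then show ?thesis using xm by simp
  qed
  define \<phi> where "\<phi> u = y (inv x u)" for u
  have \<phi>: "\<phi> (x a) = y a" for a
    unfolding \<phi>_def by (rule eq1) (simp add: f_inv_into_f)
  have inj: "inj_on \<phi> (mspace m)"
    unfolding m by (rule inj_onI) (auto simp: \<phi> intro: eq2)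
  have bij: "bij_betw \<phi> (mspace m) (mspace n)"
    unfolding bij_betw_def by (rule conjI[OF inj]) (auto simp: m n \<phi> image_image)
  have inv: "inv_into (mspace m) \<phi> (y a) = x a" for a
    using inv_into_f_f[OF inj xm[of a]] by (simp add: \<phi>)
  have "Lipschitz_continuous_map m n \<phi>"
    unfolding Lipschitz_continuous_map_def
  proof (intro conjI exI[of _ K] ballI)
    show "mdist n (\<phi> u) (\<phi> v) \<le> K * mdist m u v" if "u \<in> mspace m" "v \<in> mspace m" for u v
      using that up unfolding m by (auto simp: \<phi>)
  qed (use bij in \<open>auto simp: bij_betw_def\<close>)
  moreover have "Lipschitz_continuous_map n m (inv_into (mspace m) \<phi>)"
    unfolding Lipschitz_continuous_map_def
  proof (intro conjI exI[of _ K] ballI)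
    show "mdist m (inv_into (mspace m) \<phi> u) (inv_into (mspace m) \<phi> v) \<le> K * mdist n u v"
      if "u \<in> mspace n" "v \<in> mspace n" for u v
      using that lo unfolding n by (auto simp: inv)
  qed (use inv xm in \<open>auto simp: n\<close>)
  moreover have "z \<in> R k \<longleftrightarrow> restrict (\<phi> \<circ> z) {..<k} \<in> S k"
    if k: "k \<ge> 1" and z: "z \<in> {..<k} \<rightarrow>\<^sub>E mspace m" for k z
  proof -
    define t where "t j = inv x (z j)" for j
    have t: "x (t j) = z j" if "j < k" for j
      using z that unfolding t_def m by (intro f_inv_into_f) (auto simp: PiE_iff)
    have "restrict (x \<circ> t) {..<k} = z"
      using t z by (intro ext) (auto simp: PiE_iff extensional_def)
    moreover have "restrict (y \<circ> t) {..<k} = restrict (\<phi> \<circ> z) {..<k}"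
      using t \<phi> by (intro ext) (auto simp flip: t)
    ultimately show ?thesis using RS[OF k, of t] by simp
  qed
  ultimately show ?thesis using bij unfolding bi_Lipschitz_isomorphism_def by blast
qed

text \<open>Clamping makes the coding below total on real sequences, so that its continuity can be
  stated on the whole space.\<close>

definition clamp01 :: "real \<Rightarrow> real" where
  "clamp01 t = max 0 (min 1 t)"

text \<open>\<open>None\<close> is the limit point. The pair with index \<open>i\<close> lies
  between 3 and 4 times \<open>(1/2) ^ i\<close>, and all later points lie below
  \<open>2 * (1/2) ^ i\<close>. The offset 3 thus leaves a gap of at least \<open>(1/2) ^ i\<close>,
  whatever the sequence.\<close>

fun line_point :: "(nat \<Rightarrow> real) \<Rightarrow> (nat \<times> bool) option \<Rightarrow> real" where
  "line_point g None = 0"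
| "line_point g (Some (i, b)) = (3 + (if b then clamp01 (g i) else 0)) * (1/2) ^ i"

lemma clamp01_bounds: "0 \<le> clamp01 t" "clamp01 t \<le> 1"
  by (auto simp: clamp01_def)

lemma line_point_bounds:
  "3 * (1/2) ^ i \<le> line_point g (Some (i, b))" "line_point g (Some (i, b)) \<le> 4 * (1/2) ^ i"
  using clamp01_bounds[of "g i"] by auto

lemma line_point_separated:
  assumes "b = None \<or> (\<exists>j c. b = Some (j, c) \<and> i < j)"
  shows "(1/2) ^ i \<le> \<bar>line_point g (Some (i, s)) - line_point g b\<bar>"
    "\<bar>line_point g (Some (i, s)) - line_point g b\<bar> \<le> 4 * (1/2) ^ i"
proof -
  have b: "0 \<le> line_point g b \<and> line_point g b \<le> 2 * (1/2) ^ i"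
  proof (cases "b = None")
    case False
    then obtain j c where j: "b = Some (j, c)" "i < j" using assms by auto
    have "(1/2 :: real) ^ j \<le> (1/2) ^ Suc i"
      using j(2) by (intro power_decreasing) auto
    then have "4 * (1/2 :: real) ^ j \<le> 2 * (1/2) ^ i" by simp
    moreover have "0 \<le> (1/2 :: real) ^ j" by simp
    ultimately show ?thesis using line_point_bounds[where i = j and b = c and g = g] unfolding j(1) by linarith
  qed simp
  have "0 \<le> (1/2 :: real) ^ i" by simp
  then show "(1/2) ^ i \<le> \<bar>line_point g (Some (i, s)) - line_point g b\<bar>"
    "\<bar>line_point g (Some (i, s)) - line_point g b\<bar> \<le> 4 * (1/2) ^ i"
    using b line_point_bounds[where i = i and b = s and g = g] by linarith+
qed

text \<open>Between points of different groups the distance is known up to a factor 4 independently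
  of the sequence, hence \<open>K \<ge> 4\<close>. Inside a pair it is the clamped term times
  \<open>(1/2) ^ i\<close>, and the hypothesis applies.\<close>

lemma line_point_Lipschitz:
  assumes gh: "\<And>i. clamp01 (g i) \<le> K * clamp01 (h i)" and K: "K \<ge> 4"
  shows "\<bar>line_point g a - line_point g b\<bar> \<le> K * \<bar>line_point h a - line_point h b\<bar>"
proof -
  have far: "\<bar>line_point g (Some (i, s)) - line_point g b\<bar> \<le> K * \<bar>line_point h (Some (i, s)) - line_point h b\<bar>"
    if "b = None \<or> (\<exists>j c. b = Some (j, c) \<and> i < j)" for i s b
  proof -
    have "4 * (1/2) ^ i \<le> K * (1/2) ^ i" using K by simp
    also have "\<dots> \<le> K * \<bar>line_point h (Some (i, s)) - line_point h b\<bar>"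
      using K by (intro mult_left_mono line_point_separated(1)[OF that]) simp
    finally show ?thesis using line_point_separated(2)[OF that, of g s] by linarith
  qed
  have near: "\<bar>line_point g (Some (i, s)) - line_point g (Some (i, t))\<bar>
      \<le> K * \<bar>line_point h (Some (i, s)) - line_point h (Some (i, t))\<bar>" for i s t
  proof (cases "s = t")
    case False
    have eq: "\<bar>line_point f (Some (i, s)) - line_point f (Some (i, t))\<bar> = clamp01 (f i) * (1/2) ^ i" for f
      using False clamp01_bounds(1)[of "f i"] by (cases s; cases t) (auto simp: algebra_simps abs_mult)
    show ?thesis
      using mult_right_mono[OF gh[of i], of "(1/2) ^ i"] unfolding eq by (simp add: mult.assoc)
  qed simp
  show ?thesis
  proof (cases a)
    case None
    show ?thesis
    proof (cases b)
      case (Some q)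
      then show ?thesis using far[of None "fst q" "snd q"] None by simp
    qed (simp add: None)
  next
    case a: (Some p)
    obtain i s where p: "p = (i, s)" by (cases p)
    show ?thesis
    proof (cases b)
      case None
      then show ?thesis using far[of None i s] a p by simp
    next
      case b: (Some q)
      obtain j t where q: "q = (j, t)" by (cases q)
      consider "i < j" | "i = j" | "j < i" by linarith
      then show ?thesis
      proof cases
        case 1
        then show ?thesis using far[of b i s] a b p q by auto
      next
        case 2
        then show ?thesis using near[of i s t] a b p q by simp
      next
        case 3
        then have "\<bar>line_point g b - line_point g a\<bar> \<le> K * \<bar>line_point h b - line_point h a\<bar>"
          using far[of a j t] a b p q by auto
        then show ?thesis by (simp only: abs_minus_commute)
      qed
    qed
  qed
qed

lemma compact_line_points: "compact (range (line_point g))"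
proof -
  have lim: "(\<lambda>i. line_point g (Some (i, b))) \<longlonglongrightarrow> 0" for b
  proof (rule tendsto_sandwich)
    show "\<forall>\<^sub>F i in sequentially. 3 * (1/2) ^ i \<le> line_point g (Some (i, b))"
      "\<forall>\<^sub>F i in sequentially. line_point g (Some (i, b)) \<le> 4 * (1/2) ^ i"
      by (intro always_eventually allI line_point_bounds)+
    show "(\<lambda>i. 3 * (1/2) ^ i :: real) \<longlonglongrightarrow> 0" "(\<lambda>i. 4 * (1/2) ^ i :: real) \<longlonglongrightarrow> 0"
      by (intro tendsto_mult_right_zero LIMSEQ_realpow_zero; simp)+
  qed
  have "compact (insert 0 (range (\<lambda>i. line_point g (Some (i, True)))) \<union>
      insert 0 (range (\<lambda>i. line_point g (Some (i, False)))))"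
    by (intro compact_Un compact_sequence_with_limit lim)
  moreover have "insert 0 (range (\<lambda>i. line_point g (Some (i, True)))) \<union>
      insert 0 (range (\<lambda>i. line_point g (Some (i, False)))) = range (line_point g)" (is "?L = ?R")
  proof (intro equalityI subsetI)
    fix x assume "x \<in> ?R"
    then obtain a where a: "x = line_point g a" by blast
    show "x \<in> ?L"
    proof (cases a)
      case (Some p)
      obtain i b where p: "p = (i, b)" by (cases p)
      show ?thesis unfolding a Some p
        using rangeI[of "\<lambda>i. line_point g (Some (i, True))" i] rangeI[of "\<lambda>i. line_point g (Some (i, False))" i]
        by (cases b) (simp_all del: line_point.simps)
    qed (simp add: a)
  next
    fix x assume "x \<in> ?L"
    then show "x \<in> ?R" using rangeI[of "line_point g" None] by (auto simp del: line_point.simps(2))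
  qed
  ultimately show ?thesis by simp
qed

section \<open>Coding a sequence by a structure in the Urysohn space\<close>

definition diagonal :: "nat \<Rightarrow> 'a \<Rightarrow> nat \<Rightarrow> 'a" where
  "diagonal k x = restrict (\<lambda>_. x) {..<k}"

text \<open>There is only one relation of each arity, so the arity is used as the name of the pair,
  and constant tuples let a relation of arity \<open>k\<close> mark single points. Arities start at
  1, hence the index \<open>k - 1\<close>.\<close>

definition line_structure :: "(real \<Rightarrow> 'a) \<Rightarrow> (nat \<Rightarrow> real) \<Rightarrow> 'a set \<times> (nat \<Rightarrow> (nat \<Rightarrow> 'a) set)" where
  "line_structure e g = (range (e \<circ> line_point g),
     restrict (\<lambda>k. range (\<lambda>b. diagonal k (e (line_point g (Some (k - 1, b)))))) {1..})"

lemma isometry_continuous_map: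
  assumes "isometry_on (mspace m) m U e"
  shows "continuous_map (mtopology_of m) (mtopology_of U) e"
proof -
  have "Lipschitz_continuous_map m U e"
    using assms unfolding Lipschitz_continuous_map_def isometry_on_def by (auto intro!: exI[of _ 1])
  then show ?thesis
    by (intro uniformly_continuous_imp_continuous_map Lipschitz_imp_uniformly_continuous_map)
qed

lemma continuous_map_diagonal: "continuous_map X (power_topology X k) (diagonal k)"
  unfolding continuous_map_componentwise diagonal_def by (auto simp: image_subset_iff)

lemma line_structure_code:
  assumes e: "isometry_on UNIV euclidean_metric U e"
  shows "line_structure e g \<in> structure_codes U"
proof -
  have eU: "e x \<in> mspace U" for x using e unfolding isometry_on_def by auto
  have ce: "continuous_map euclidean (mtopology_of U) e"
    using isometry_continuous_map[of euclidean_metric U e] e by simp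
  let ?M = "range (e \<circ> line_point g)"
  have "compactin euclidean (range (line_point g))" using compact_line_points by simp
  from image_compactin[OF this ce] have "compactin (mtopology_of U) ?M"
    by (simp add: image_comp)
  then have "compact_space (mtopology_of (submetric U ?M))"
    by (simp add: mtopology_of_submetric compactin_subspace)
  moreover have "closedin (power_topology (mtopology_of (submetric U ?M)) k)
      (range (\<lambda>b. diagonal k (e (line_point g (Some (k - 1, b))))))" for k
  proof (rule closedin_Hausdorff_finite)
    have "Hausdorff_space (mtopology_of (submetric U ?M))"
      unfolding mtopology_of_def by (rule Metric_space.Hausdorff_space_mtopology[OF Metric_space_mspace_mdist])
    then show "Hausdorff_space (power_topology (mtopology_of (submetric U ?M)) k)"
      unfolding Hausdorff_space_product_topology by simp
    show "range (\<lambda>b. diagonal k (e (line_point g (Some (k - 1, b)))))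
        \<subseteq> topspace (power_topology (mtopology_of (submetric U ?M)) k)"
      using eU unfolding diagonal_def by (auto simp del: line_point.simps split: if_splits)
  qed simp
  ultimately show ?thesis
    using eU unfolding structure_codes_def compact_metric_structure_def line_structure_def
    by (auto simp del: line_point.simps)
qed

text \<open>An isomorphism respects the relation of arity \<open>Suc i\<close>, so it sends the
  marked pair \<open>i\<close> into the marked pair \<open>i\<close>. The Lipschitz bound of its
  inverse then compares the two terms, and the factor \<open>(1/2) ^ i\<close> cancels. Conversely,
  comparable sequences make the map between points of equal index bi-Lipschitz.\<close>

lemma line_structure_iff:
  assumes e: "isometry_on UNIV euclidean_metric U e"
    and g: "\<And>i. g i \<in> {0..1}" and h: "\<And>i. h i \<in> {0..1}"
  shows "(line_structure e g, line_structure e h) \<in> bi_Lipschitz_isomorphic U \<longleftrightarrow> comparable g h"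
proof -
  let ?x = "\<lambda>f. e \<circ> line_point f"
  define M where "M f = range (?x f)" for f
  define R where "R f = restrict (\<lambda>k. range (\<lambda>b. diagonal k (?x f (Some (k - 1, b))))) {1..}" for f
  have ls: "line_structure e f = (M f, R f)" for f
    unfolding line_structure_def M_def R_def by (simp only: comp_def)
  have code: "(M f, R f) \<in> structure_codes U" for f
    using line_structure_code[OF e, of f] unfolding ls .
  have Rk: "R f k = range (\<lambda>b. diagonal k (?x f (Some (k - 1, b))))" if "k \<ge> 1" for f k
    using that unfolding R_def by simp
  have RS: "R f (Suc i) = range (\<lambda>b. diagonal (Suc i) (?x f (Some (i, b))))" for f i
  proof -
    have "1 \<le> Suc i" by simp
    from Rk[OF this] show ?thesis unfolding diff_Suc_1 .
  qed
  have clamp: "clamp01 (g i) = g i" "clamp01 (h i) = h i" for i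
    using g[of i] h[of i] by (simp_all add: clamp01_def)
  have dist: "mdist U (?x f a) (?x f b) = \<bar>line_point f a - line_point f b\<bar>" for f a b
    using e unfolding isometry_on_def by (simp add: dist_real_def)
  let ?m = "\<lambda>f. submetric U (M f)"
  have mm: "mspace (?m f) = range (?x f)" for f
    using structure_codesD(2)[OF code] unfolding M_def .
  have iso: "(line_structure e g, line_structure e h) \<in> bi_Lipschitz_isomorphic U \<longleftrightarrow>
      (\<exists>\<phi>. bi_Lipschitz_isomorphism (?m g) (R g) (?m h) (R h) \<phi>)"
    unfolding ls bi_Lipschitz_isomorphic_def using code by simp
  have one: "\<exists>K. \<forall>i. clamp01 (f i) \<le> K * clamp01 (f' i)"
    if \<phi>: "bi_Lipschitz_isomorphism (?m f) (R f) (?m f') (R f') \<phi>" for f f' \<phi>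
  proof -
    obtain c :: nat where c: "\<And>x y. x \<in> mspace (?m f) \<Longrightarrow> y \<in> mspace (?m f) \<Longrightarrow>
        mdist (?m f) x y \<le> 2 ^ c * mdist (?m f') (\<phi> x) (\<phi> y)"
      using bi_Lipschitz_isomorphism_scale[OF \<phi>] by metis
    have "clamp01 (f i) \<le> 2 ^ c * clamp01 (f' i)" for i
    proof -
      let ?k = "Suc i"
      have img: "\<exists>b'. \<phi> (?x f (Some (i, b))) = ?x f' (Some (i, b'))" for b
      proof -
        let ?d = "diagonal ?k (?x f (Some (i, b)))"
        have "?d \<in> R f ?k" unfolding RS by (auto simp del: line_point.simps)
        moreover have "?d \<in> {..<?k} \<rightarrow>\<^sub>E mspace (?m f)"
          unfolding mm diagonal_def by (auto simp del: line_point.simps)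
        ultimately have "restrict (\<phi> \<circ> ?d) {..<?k} \<in> R f' ?k"
          using \<phi> unfolding bi_Lipschitz_isomorphism_def by (metis le_add1 plus_1_eq_Suc)
        then obtain b' where "restrict (\<phi> \<circ> ?d) {..<?k} = diagonal ?k (?x f' (Some (i, b')))"
          unfolding RS by auto
        from fun_cong[OF this, of 0] have "\<phi> (?x f (Some (i, b))) = ?x f' (Some (i, b'))"
          by (simp add: diagonal_def del: line_point.simps)
        then show ?thesis by blast
      qed
      obtain b0 b1 where b: "\<phi> (?x f (Some (i, False))) = ?x f' (Some (i, b0))"
        "\<phi> (?x f (Some (i, True))) = ?x f' (Some (i, b1))"
        using img[of False] img[of True] by (elim exE)
      have "mdist (?m f) (?x f (Some (i, False))) (?x f (Some (i, True)))
          \<le> 2 ^ c * mdist (?m f') (\<phi> (?x f (Some (i, False)))) (\<phi> (?x f (Some (i, True))))"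
        by (rule c) (simp_all only: mm rangeI)
      then have "mdist U (?x f (Some (i, False))) (?x f (Some (i, True)))
          \<le> 2 ^ c * mdist U (?x f' (Some (i, b0))) (?x f' (Some (i, b1)))"
        unfolding mdist_submetric b .
      moreover have "mdist U (?x f (Some (i, False))) (?x f (Some (i, True))) = clamp01 (f i) * (1/2) ^ i"
        unfolding dist using clamp01_bounds(1)[of "f i"] by (simp add: algebra_simps)
      \<comment> \<open>Only an upper bound is available: the isomorphism may exchange the two
        marked points, and \<open>b0 = b1\<close> is possible when the pair has collapsed.\<close>
      moreover have "mdist U (?x f' (Some (i, b0))) (?x f' (Some (i, b1))) \<le> clamp01 (f' i) * (1/2) ^ i"
        unfolding dist using clamp01_bounds(1)[of "f' i"] by (cases b0; cases b1) (auto simp: algebra_simps)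
      ultimately have "clamp01 (f i) * (1/2) ^ i \<le> 2 ^ c * (clamp01 (f' i) * (1/2) ^ i)"
        by (smt (verit) mult_left_mono zero_le_power)
      then have "clamp01 (f i) * (1/2) ^ i \<le> (2 ^ c * clamp01 (f' i)) * (1/2) ^ i"
        by (simp only: mult.assoc)
      then show ?thesis by (rule mult_right_le_imp_le) simp
    qed
    then show ?thesis by blast
  qed
  show ?thesis unfolding iso
  proof
    assume "\<exists>\<phi>. bi_Lipschitz_isomorphism (?m g) (R g) (?m h) (R h) \<phi>"
    then obtain \<phi> where \<phi>: "bi_Lipschitz_isomorphism (?m g) (R g) (?m h) (R h) \<phi>" ..
    obtain K where K: "\<And>i. g i \<le> K * h i" using one[OF \<phi>] unfolding clamp by blast
    obtain L where L: "\<And>i. h i \<le> L * g i"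
      using one[OF bi_Lipschitz_isomorphic_sym[OF \<phi>]] unfolding clamp by blast
    have "g i \<le> max K L * h i \<and> h i \<le> max K L * g i" for i
      using K[of i] L[of i] mult_right_mono[of K "max K L" "h i"] mult_right_mono[of L "max K L" "g i"]
        g[of i] h[of i] by auto
    then show "comparable g h" unfolding comparable_def by blast
  next
    assume "comparable g h"
    then obtain K where K: "\<And>i. g i \<le> K * h i" "\<And>i. h i \<le> K * g i" unfolding comparable_def by blast
    have K': "clamp01 (g i) \<le> max K 4 * clamp01 (h i)" "clamp01 (h i) \<le> max K 4 * clamp01 (g i)" for i
      unfolding clamp
      using K[of i] mult_right_mono[of K "max K 4" "h i"] mult_right_mono[of K "max K 4" "g i"]
        g[of i] h[of i] by auto
    have up: "\<bar>line_point h a - line_point h b\<bar> \<le> max K 4 * \<bar>line_point g a - line_point g b\<bar>" for a b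
      by (rule line_point_Lipschitz[OF K'(2)]) simp
    have lo: "\<bar>line_point g a - line_point g b\<bar> \<le> max K 4 * \<bar>line_point h a - line_point h b\<bar>" for a b
      by (rule line_point_Lipschitz[OF K'(1)]) simp
    \<comment> \<open>Membership in a relation is a statement about equalities between points, so it
      transfers once both parametrizations identify the same indices.\<close>
    have same: "?x g a = ?x g b \<longleftrightarrow> ?x h a = ?x h b" for a b
    proof -
      have "?x f a = ?x f b \<longleftrightarrow> \<bar>line_point f a - line_point f b\<bar> = 0" for f
      proof -
        have "?x f a \<in> mspace U" "?x f b \<in> mspace U" using e unfolding isometry_on_def by auto
        then show ?thesis unfolding dist[symmetric] by (rule mdist_zero[symmetric])
      qed
      moreover have "\<bar>line_point g a - line_point g b\<bar> = 0 \<longleftrightarrow> \<bar>line_point h a - line_point h b\<bar> = 0"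
        using up[of a b] lo[of a b] by auto
      ultimately show ?thesis by simp
    qed
    show "\<exists>\<phi>. bi_Lipschitz_isomorphism (?m g) (R g) (?m h) (R h) \<phi>"
    proof (rule bi_Lipschitz_isomorphism_indexed[OF mm mm, where K = "max K 4"])
      show "mdist (?m h) (?x h a) (?x h b) \<le> max K 4 * mdist (?m g) (?x g a) (?x g b)"
        "mdist (?m g) (?x g a) (?x g b) \<le> max K 4 * mdist (?m h) (?x h a) (?x h b)" for a b
        unfolding mdist_submetric dist by (rule up, rule lo)
      fix k :: nat and t assume k: "k \<ge> 1"
      have char: "restrict (?x f \<circ> t) {..<k} \<in> R f k \<longleftrightarrow>
          (\<exists>b. \<forall>j<k. ?x f (t j) = ?x f (Some (k - 1, b)))" for f
        unfolding Rk[OF k] diagonal_def restrict_def image_iff fun_eq_iff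
        by (auto simp del: line_point.simps)
      show "restrict (?x g \<circ> t) {..<k} \<in> R g k \<longleftrightarrow> restrict (?x h \<circ> t) {..<k} \<in> R h k"
        unfolding char same ..
    qed
  qed
qed

section \<open>Continuity of the coding\<close>

lemma continuous_map_Vietoris:
  assumes c: "\<And>p. p \<in> topspace T \<Longrightarrow> compactin X (f p)"
    and sub: "\<And>V. openin X V \<Longrightarrow> openin T {p \<in> topspace T. f p \<subseteq> V}"
    and meet: "\<And>V. openin X V \<Longrightarrow> openin T {p \<in> topspace T. f p \<inter> V \<noteq> {}}"
  shows "continuous_map T (Vietoris_topology X) f"
  unfolding Vietoris_topology_def
proof (rule continuous_on_generated_topo)
  let ?B = "{{K. compactin X K \<and> K \<subseteq> V} | V. openin X V} \<union>
      {{K. compactin X K \<and> K \<inter> V \<noteq> {}} | V. openin X V}"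
  have "\<Union>?B = topspace (Vietoris_topology X)"
    unfolding Vietoris_topology_def topology_generated_by_topspace ..
  then show "f ` topspace T \<subseteq> \<Union>?B" using c unfolding topspace_Vietoris by auto
  fix W assume "W \<in> ?B"
  then consider V where "openin X V" "W = {K. compactin X K \<and> K \<subseteq> V}"
    | V where "openin X V" "W = {K. compactin X K \<and> K \<inter> V \<noteq> {}}" by blast
  then show "openin T (f -` W \<inter> topspace T)"
  proof cases
    case 1
    have "f -` W \<inter> topspace T = {p \<in> topspace T. f p \<subseteq> V}" using c 1(2) by auto
    then show ?thesis using sub[OF 1(1)] by simp
  next
    case 2
    have "f -` W \<inter> topspace T = {p \<in> topspace T. f p \<inter> V \<noteq> {}}" using c 2(2) by auto
    then show ?thesis using meet[OF 2(1)] by simp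
  qed
qed

lemma continuous_on_line_point: "continuous_on UNIV (\<lambda>g. line_point g a)"
proof (cases a)
  case (Some p)
  obtain i b where p: "p = (i, b)" by (cases p)
  have "continuous_on UNIV (\<lambda>g :: nat \<Rightarrow> real. g i)" by simp
  then show ?thesis
    unfolding Some p line_point.simps clamp01_def by (cases b) (auto intro!: continuous_intros)
qed simp

text \<open>The obstacle is that a carrier inside an open set is a condition on infinitely many
  points. An open set containing the limit point 0 absorbs all points of large index, uniformly in
  the sequence, so finitely many conditions remain; if it misses 0, no carrier lies in it. The
  relations are finite and cause no such trouble.\<close>

lemma continuous_map_line_structure:
  assumes e: "isometry_on UNIV euclidean_metric U e"
  shows "continuous_map euclidean (structure_topology U) (line_structure e)"
proof -
  have ce: "continuous_map euclidean (mtopology_of U) e"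
    using isometry_continuous_map[of euclidean_metric U e] e by simp
  have cd: "continuous_map euclidean (power_topology (mtopology_of U) k) (\<lambda>x. diagonal k (e x))" for k
    using continuous_map_compose[OF ce continuous_map_diagonal] by (simp add: comp_def)
  have open_pre: "open (f -` V)" if "continuous_map euclidean X f" "openin X V"
    for X :: "'c topology" and f :: "real \<Rightarrow> 'c" and V
    using openin_continuous_map_preimage[OF that] by (simp add: vimage_def)
  have op: "open {g. line_point g a \<in> W}" if "open W" for a W
    using open_vimage[OF that continuous_on_line_point] by (simp add: vimage_def)
  have code: "line_structure e g \<in> topspace (structure_topology U)" for g
    unfolding topspace_structure_topology by (rule line_structure_code[OF e])
  have "compactin (mtopology_of U) (fst (line_structure e g))" for g
    using continuous_map_carrier[of U] code[of g]
    by (auto simp: continuous_map_def topspace_Vietoris Pi_iff)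
  then have fst: "continuous_map euclidean (Vietoris_topology (mtopology_of U)) (\<lambda>g. fst (line_structure e g))"
  proof (rule continuous_map_Vietoris)
    fix V assume V: "openin (mtopology_of U) V"
    define W where "W = e -` V"
    have W: "open W" unfolding W_def by (rule open_pre[OF ce V])
    have "open {g. range (line_point g) \<subseteq> W}"
    proof (cases "0 \<in> W")
      case False
      then have "{g. range (line_point g) \<subseteq> W} = {}"
        using rangeI[of "line_point _" None] by (auto simp del: line_point.simps(2))
      then show ?thesis by simp
    next
      case True
      then obtain \<delta> where \<delta>: "\<delta> > 0" "ball 0 \<delta> \<subseteq> W" using W openE by blast
      \<comment> \<open>Points of index \<open>i\<close> are at most \<open>4 * (1/2) ^ i\<close>,
        hence the division by 4.\<close>
      obtain n where n: "(1/2 :: real) ^ n < \<delta> / 4"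
        using real_arch_pow_inv[of "\<delta> / 4" "1/2 :: real"] \<delta>(1) by auto
      have tail: "line_point g (Some (i, b)) \<in> W" if "i \<ge> n" for g i b
      proof -
        have "(1/2 :: real) ^ i \<le> (1/2) ^ n" using that by (intro power_decreasing) auto
        moreover have "0 \<le> (1/2 :: real) ^ i" by simp
        ultimately have "\<bar>line_point g (Some (i, b))\<bar> < \<delta>"
          using n line_point_bounds[where i = i and b = b and g = g] by linarith
        then show ?thesis using \<delta>(2) by (auto simp del: line_point.simps)
      qed
      have "{g. range (line_point g) \<subseteq> W} = (\<Inter>a\<in>{..<n} \<times> UNIV. {g. line_point g (Some a) \<in> W})"
      proof (intro equalityI subsetI)
        fix g assume g: "g \<in> (\<Inter>a\<in>{..<n} \<times> UNIV. {g. line_point g (Some a) \<in> W})"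
        have "line_point g a \<in> W" for a
        proof (cases a)
          case (Some p)
          obtain i b where p: "p = (i, b)" by (cases p)
          show ?thesis
          proof (cases "i < n")
            case True
            then have "p \<in> {..<n} \<times> UNIV" using p by simp
            then show ?thesis using INT_D[OF g] unfolding Some by blast
          qed (use tail Some p in simp)
        qed (use True in simp)
        then show "g \<in> {g. range (line_point g) \<subseteq> W}" by blast
      qed blast
      then show ?thesis by (simp only:) (intro open_INT ballI op W; simp)
    qed
    moreover have "{g. range (line_point g) \<subseteq> W} = {g. fst (line_structure e g) \<subseteq> V}"
      unfolding W_def line_structure_def by (auto simp del: line_point.simps)
    ultimately show "openin euclidean {g \<in> topspace euclidean. fst (line_structure e g) \<subseteq> V}" by simp
    have "open {g. \<exists>a. line_point g a \<in> W}" by (intro open_Collect_ex op W)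
    moreover have "{g. \<exists>a. line_point g a \<in> W} = {g. fst (line_structure e g) \<inter> V \<noteq> {}}"
      unfolding W_def line_structure_def by (auto simp del: line_point.simps)
    ultimately show "openin euclidean {g \<in> topspace euclidean. fst (line_structure e g) \<inter> V \<noteq> {}}" by simp
  qed
  have rel: "continuous_map euclidean (Vietoris_topology (power_topology (mtopology_of U) k))
      (\<lambda>g. snd (line_structure e g) k)" if k: "k \<ge> 1" for k
  proof (rule continuous_map_Vietoris)
    show "compactin (power_topology (mtopology_of U) k) (snd (line_structure e g) k)" for g
      using continuous_map_relation[OF k, of U] code[of g]
      by (auto simp: continuous_map_def topspace_Vietoris Pi_iff)
    fix V assume V: "openin (power_topology (mtopology_of U) k) V"
    define W where "W = (\<lambda>x. diagonal k (e x)) -` V"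
    have W: "open W" unfolding W_def by (rule open_pre[OF cd V])
    have R: "snd (line_structure e g) k = (\<lambda>b. diagonal k (e (line_point g (Some (k - 1, b))))) ` UNIV" for g
      using k unfolding line_structure_def by simp
    have "open (\<Inter>b\<in>(UNIV :: bool set). {g. line_point g (Some (k - 1, b)) \<in> W})"
      by (intro open_INT ballI op W) simp
    moreover have "(\<Inter>b\<in>(UNIV :: bool set). {g. line_point g (Some (k - 1, b)) \<in> W}) =
        {g. snd (line_structure e g) k \<subseteq> V}"
      unfolding W_def R by (auto simp del: line_point.simps)
    ultimately show "openin euclidean {g \<in> topspace euclidean. snd (line_structure e g) k \<subseteq> V}" by simp
    have "open {g. \<exists>b. line_point g (Some (k - 1, b)) \<in> W}" by (intro open_Collect_ex op W)
    moreover have "{g. \<exists>b. line_point g (Some (k - 1, b)) \<in> W} = {g. snd (line_structure e g) k \<inter> V \<noteq> {}}"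
      unfolding W_def R by (auto simp del: line_point.simps)
    ultimately show "openin euclidean {g \<in> topspace euclidean. snd (line_structure e g) k \<inter> V \<noteq> {}}" by simp
  qed
  have "continuous_map euclidean
      (product_topology (\<lambda>k. Vietoris_topology (power_topology (mtopology_of U) k)) {1..})
      (\<lambda>g. snd (line_structure e g))"
    unfolding continuous_map_componentwise
  proof (intro conjI ballI)
    show "(\<lambda>g. snd (line_structure e g)) ` topspace euclidean \<subseteq> extensional {1..}"
      unfolding line_structure_def by auto
  qed (use rel in simp)
  then show ?thesis
    unfolding structure_topology_def continuous_map_in_subtopology continuous_map_pairwise comp_def
    using fst line_structure_code[OF e] by auto
qed

section \<open>Assembling the two reductions\<close>

lemma Borel_reducible_trans:
  assumes "Borel_reducible A E B F" "Borel_reducible B F C G"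
  shows "Borel_reducible A E C G"
proof -
  obtain f where f: "f \<in> measurable A B" "\<forall>x\<in>space A. \<forall>y\<in>space A. (x, y) \<in> E \<longleftrightarrow> (f x, f y) \<in> F"
    using assms(1) unfolding Borel_reducible_def by (elim bexE)
  obtain g where g: "g \<in> measurable B C" "\<forall>x\<in>space B. \<forall>y\<in>space B. (x, y) \<in> F \<longleftrightarrow> (g x, g y) \<in> G"
    using assms(2) unfolding Borel_reducible_def by (elim bexE)
  have "(x, y) \<in> E \<longleftrightarrow> ((g \<circ> f) x, (g \<circ> f) y) \<in> G" if "x \<in> space A" "y \<in> space A" for x y
    using f(2) g(2) that measurable_space[OF f(1)] by simp
  then show ?thesis
    unfolding Borel_reducible_def using measurable_comp[OF f(1) g(1)] by (intro bexI[of _ "g \<circ> f"]) simp_all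
qed

lemma borel_of_euclidean: "borel_of euclidean = borel"
  unfolding borel_of_def borel_def by simp

theorem theorem8p2:
  fixes U :: "'a metric" and X :: "'b topology" and E :: "('b \<times> 'b) set"
  assumes "Urysohn_space U"
    and "complete_K_sigma_equivalence X E"
  shows "Borel_bireducible
           (borel_of (structure_topology U)) (bi_Lipschitz_isomorphic U)
           (borel_of X) E"
  unfolding Borel_bireducible_def
proof
  let ?Y = "top_of_set (bit_sequences :: (test list \<times> nat \<Rightarrow> real) set)"
  have "Borel_reducible (borel_of (structure_topology U)) (bi_Lipschitz_isomorphic U)
      (borel_of ?Y) shift_equivalence"
    unfolding Borel_reducible_def space_borel_of topspace_structure_topology
    by (intro bexI[OF _ measurable_pass_code] ballI) (clarify, rule pass_code_iff)
  then show "Borel_reducible (borel_of (structure_topology U)) (bi_Lipschitz_isomorphic U) (borel_of X) E"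
    by (rule Borel_reducible_trans) (rule complete_K_sigma_reducible[OF assms(2) K_sigma_shift_equivalence])
next
  \<comment> \<open>Universality of the Urysohn space, applied to the real line, supplies the
    isometric copy of the line that carries the coding structures.\<close>
  have "separable_space (mtopology_of (euclidean_metric :: real metric))"
    by (simp add: second_countable_imp_separable_space second_countable_euclidean)
  from Urysohn_universal[OF assms(1) this] obtain e where e: "isometry_on UNIV (euclidean_metric :: real metric) U e"
    by auto
  have "K_sigma_equivalence X E" using assms(2) unfolding complete_K_sigma_equivalence_def ..
  from K_sigma_comparable_reduction[OF this] obtain F :: "'b \<Rightarrow> nat \<Rightarrow> real"
    where F: "F \<in> borel_measurable (borel_of X)" and F01: "\<forall>x i. F x i \<in> {0..1}"
      and E: "\<forall>x\<in>topspace X. \<forall>y\<in>topspace X. (x, y) \<in> E \<longleftrightarrow> comparable (F x) (F y)"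
    by (elim exE conjE)
  have "line_structure e \<circ> F \<in> measurable (borel_of X) (borel_of (structure_topology U))"
    using continuous_map_borel_of[OF continuous_map_line_structure[OF e]] F
    unfolding borel_of_euclidean by (rule measurable_comp[rotated])
  moreover have "(x, y) \<in> E \<longleftrightarrow> ((line_structure e \<circ> F) x, (line_structure e \<circ> F) y) \<in> bi_Lipschitz_isomorphic U"
    if "x \<in> topspace X" "y \<in> topspace X" for x y
    using E that line_structure_iff[OF e, of "F x" "F y"] F01 by simp
  ultimately show "Borel_reducible (borel_of X) E (borel_of (structure_topology U)) (bi_Lipschitz_isomorphic U)"
    unfolding Borel_reducible_def space_borel_of by (intro bexI[of _ "line_structure e \<circ> F"]) simp_all
qed

end
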